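(* Let $n$ be an even positive integer and let $k,m,z$ be complex numbers such that all the functions below are defined. Then $$\sum _{r=1}^{\frac{n-2}{2}} \left(e^{\frac{2 i \pi m r}{n}}\, \Phi \left(e^{2 i m \pi },-k,\frac{r}{n}+\frac{z}{2}\right)+(-1)^{2 m} e^{-\frac{2 i \pi m r}{n}}\, \Phi \left(e^{2 i m \pi },-k,\frac{1}{2} \left(-\frac{2 r}{n}+z+2\right)\right)\right)$$ $$=n^{-k}\, \Phi \left(e^{\frac{2 i m \pi }{n}},-k,\frac{n z}{2}\right)-2^{-k}\, \Phi \left(e^{i m \pi },-k,z\right).$$
   Context: $\Phi(z,s,v)$ is the Hurwitz–Lerch zeta function: $\Phi(z,s,v)=\sum_{j=0}^{\infty}\frac{z^j}{(j+v)^s}$ for $v\notin\{0,-1,-2,\dots\}$ and $|z|<1$ (or $|z|=1$, $\operatorname{Re}s>1$), and by analytic continuation (principal branch, cut along $z\in[1,\infty)$) for other values; $\Phi(1,s,v)$ is the Hurwitz zeta function $\zeta(s,v)$. Powers are principal values; in particular $(-1)^{2m}=e^{2\pi i m}$. *)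

theory Defs
  imports "HOL-Complex_Analysis.Complex_Analysis"
begin

text \<open>
  The value at \<open>x\<close> of the analytic continuation of \<open>f\<close> from \<open>A\<close> to \<open>D\<close>. It is meaningful when a
  continuation exists; for \<open>D\<close> open and connected and \<open>A\<close> open and non-empty the value is then unique,
  see \<open>continuation_value_eq\<close> below.
\<close>

definition continuation_value ::
    "(complex \<Rightarrow> complex) \<Rightarrow> complex set \<Rightarrow> complex set \<Rightarrow> complex \<Rightarrow> complex" where
  "continuation_value f A D x =
     (THE w. \<exists>F. F holomorphic_on D \<and> (\<forall>y\<in>A. F y = f y) \<and> w = F x)"

lemma continuation_value_eq:
  assumes "open D" "connected D" "open A" "A \<noteq> {}" "A \<subseteq> D" "x \<in> D"
    and "F holomorphic_on D" "\<And>y. y \<in> A \<Longrightarrow> F y = f y"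
  shows "continuation_value f A D x = F x"
  unfolding continuation_value_def
proof (rule the_equality)
  show "\<exists>G. G holomorphic_on D \<and> (\<forall>y\<in>A. G y = f y) \<and> F x = G x"
    using assms by blast
next
  fix w assume "\<exists>G. G holomorphic_on D \<and> (\<forall>y\<in>A. G y = f y) \<and> w = G x"
  then obtain G where G: "G holomorphic_on D" "\<forall>y\<in>A. G y = f y" "w = G x" by blast
  have "G x = F x"
    by (rule analytic_continuation_open[of A D G F]) (use assms G in auto)
  then show "w = F x" using G by simp
qed

definition lerch_series :: "complex \<Rightarrow> complex \<Rightarrow> complex \<Rightarrow> complex" where
  "lerch_series z s v = (\<Sum>j. z ^ j / (of_nat j + v) powr s)"

text \<open>Continued in \<open>s\<close>; the only singularity is the pole at \<open>s = 1\<close>.\<close>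

definition hurwitz_zeta :: "complex \<Rightarrow> complex \<Rightarrow> complex" where
  "hurwitz_zeta s v =
     (if Re s > 1 then lerch_series 1 s v
      else continuation_value (\<lambda>s. lerch_series 1 s v) {s. Re s > 1} (- {1}) s)"

definition lerch_cut :: "complex set" where
  "lerch_cut = of_real ` {1..}"

text \<open>
  Off the region of convergence, the principal branch is the continuation in \<open>z\<close> from the open
  unit disc to the plane slit along \<open>[1, \<infinity>)\<close>, for fixed \<open>s\<close> and \<open>v\<close>.
\<close>

definition lerch_phi :: "complex \<Rightarrow> complex \<Rightarrow> complex \<Rightarrow> complex" where
  "lerch_phi z s v =
     (if z = 1 then hurwitz_zeta s v
      else if norm z < 1 \<or> (norm z = 1 \<and> Re s > 1) then lerch_series z s v
      else continuation_value (\<lambda>z. lerch_series z s v) (ball 0 1) (- lerch_cut) z)"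

text \<open>
  The arguments at which \<open>lerch_phi\<close> is defined. On the cut only the endpoint \<open>z = 1\<close> is
  admitted, and there the pole \<open>s = 1\<close> of the Hurwitz zeta function is excluded.
\<close>

definition lerch_phi_defined :: "complex \<Rightarrow> complex \<Rightarrow> complex \<Rightarrow> bool" where
  "lerch_phi_defined z s v \<longleftrightarrow>
     v \<notin> \<int>\<^sub>\<le>\<^sub>0 \<and> (z \<notin> lerch_cut \<or> (z = 1 \<and> s \<noteq> 1))"

end

theory Submission
  imports Defs "HOL-Real_Asymp.Real_Asymp"
begin

text \<open>
Put \<open>s = - k\<close>. Sorting the indices of the Lerch series by their residues modulo \<open>N\<close> gives the
distribution relation

  \<open>N powr s * \<Phi>(w, s, N v) = (\<Sum>t<N. w ^ t * \<Phi>(w ^ N, s, v + t / N))\<close>;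

principal powers cause no trouble because the positive factor \<open>N\<close> always splits off. Take \<open>v = z / 2\<close>.
With \<open>N = n\<close> and \<open>w = exp (2 \<pi> \<i> m / n)\<close> the right-hand side is a sum over all \<open>t < n\<close>. With \<open>N = 2\<close> and
\<open>exp (\<pi> \<i> m) = w ^ (n / 2)\<close> in place of \<open>w\<close>, it consists of the two terms \<open>t = 0\<close> and \<open>t = n / 2\<close> of that
sum. The difference is the sum over the other \<open>t\<close>, and collecting \<open>t = r\<close> with \<open>t = n - r\<close> yields the
claim.

The work lies in carrying the distribution relation over to the continued function
(\<open>lerch_phi_distribution\<close>). If \<open>w ^ N\<close> is off the cut, both sides are holomorphic in \<open>w\<close> on
\<open>{w. w ^ N \<notin> [1, \<infinity>)}\<close>, which is starlike about \<open>0\<close> and contains the unit disc. If \<open>w ^ N = 1\<close>, the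
right-hand side consists of Hurwitz zeta values, which are continued in \<open>s\<close> and not in the first
argument. The relation is then continued in \<open>s\<close> from \<open>Re s > 1\<close>, and this needs that
\<open>\<Phi>(w, s, v)\<close>, defined for \<open>Re s \<le> 1\<close> by continuation in \<open>w\<close>, is entire in \<open>s\<close> for \<open>w \<noteq> 1\<close> on the unit
circle (\<open>lerch_phi_entire_in_exponent\<close>).

So three continuations have to be constructed, each first for \<open>Re v\<close> large enough and then
for all \<open>v\<close> by splitting off initial terms.

\<^item> In \<open>z\<close>, to the slit plane: \<open>(v + j) powr - s\<close> is, up to \<open>\<Gamma>(s)\<close>, the \<open>j\<close>-th moment of a function on the unit
  interval, so the series becomes an integral of that function against \<open>1 / (1 - z x)\<close>. This covers \<open>Re s > 1\<close>,
  and the operator \<open>z d/dz + v\<close> lowers \<open>s\<close> by one.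

\<^item> In \<open>s\<close>, for \<open>|z| \<le> 1\<close> and \<open>z \<noteq> 1\<close>: from
  \<open>(1 - z) \<Phi>(z, s, v) = v powr - s - z s \<integral> \<Phi>(z, s + 1, v + u) du\<close>, where \<open>u\<close> runs from \<open>0\<close> to \<open>1\<close>.

\<^item> In \<open>s\<close>, for \<open>z = 1\<close>: with \<open>H(s, v) = (s - 1) \<zeta>(s, v)\<close>, from
  \<open>H(s, v) = v powr (1 - s) + (s - 1) \<integral> (1 - u) H(s + 1, v + u) du\<close>.

Each of the last two equations extends a function from a half-plane in \<open>s\<close> to one that is larger
by a strip of width one, and keeps joint continuity in all variables.
\<close>

section \<open>Convergence of the Lerch series\<close>

text \<open>
The argument of \<open>x + v\<close> contributes a factor of at most \<open>exp (\<pi> |s|)\<close>. The modulus lies between \<open>x / 2\<close> and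
\<open>(1 + |v|) x\<close>, and the sign of \<open>Re s\<close> decides which of the two bounds is the relevant one. The
constant depends on \<open>|s|\<close> and \<open>|v|\<close> only, and monotonically, so the bound is locally uniform.
\<close>

lemma norm_inverse_powr_shift_le:
  fixes v s :: complex and x :: real
  assumes "x \<ge> 1" and "x / 2 \<le> norm (of_real x + v)"
  shows "norm (1 / (of_real x + v) powr s)
           \<le> exp (pi * norm s) * (2 + 2 * norm v) powr norm s * x powr (- Re s)"
proof -
  let ?y = "of_real x + v" and ?B = "2 + 2 * norm v"
  have y0: "norm ?y > 0" using assms by linarith
  have "- Im s * Arg ?y \<ge> - (pi * norm s)"
  proof -
    have "\<bar>Im s * Arg ?y\<bar> \<le> norm s * pi"
      unfolding abs_mult using abs_Im_le_cmod[of s] Arg_bounded[of ?y]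
      by (intro mult_mono) auto
    then show ?thesis by (simp add: mult.commute abs_le_iff)
  qed
  then have arg: "exp (- (- Im s * Arg ?y)) \<le> exp (pi * norm s)" by simp
  have mod: "norm ?y powr (- Re s) \<le> ?B powr norm s * x powr (- Re s)"
  proof (cases "Re s \<ge> 0")
    case True
    have "norm ?y powr (- Re s) \<le> (x / 2) powr (- Re s)"
      using assms True by (intro powr_mono2') auto
    also have "\<dots> = 2 powr (Re s) * x powr (- Re s)"
      using assms by (simp add: powr_divide powr_minus field_simps)
    also have "2 powr (Re s) \<le> ?B powr norm s"
    proof -
      have "2 powr (Re s) \<le> 2 powr norm s" by (intro powr_mono complex_Re_le_cmod) auto
      also have "\<dots> \<le> ?B powr norm s" by (intro powr_mono2) auto
      finally show ?thesis .
    qed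
    finally show ?thesis by (simp add: mult_right_mono)
  next
    case False
    have "norm ?y \<le> x + norm v" using norm_triangle_ineq[of "of_real x" v] assms by simp
    also have "norm v \<le> norm v * x" using assms by (simp add: mult_le_cancel_left1)
    also have "x + norm v * x \<le> ?B * x" using assms by (simp add: algebra_simps)
    finally have "norm ?y powr (- Re s) \<le> (?B * x) powr (- Re s)"
      using False by (intro powr_mono2) auto
    also have "\<dots> = ?B powr (- Re s) * x powr (- Re s)"
      using assms by (simp add: powr_mult)
    also have "?B powr (- Re s) \<le> ?B powr norm s"
      using abs_Re_le_cmod[of s] by (intro powr_mono) (auto simp: add_increasing2)
    finally show ?thesis by (simp add: mult_right_mono)
  qed
  have "norm (1 / ?y powr s) = norm ?y powr (- Re s) * exp (- (- Im s * Arg ?y))"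
    using y0 by (simp add: norm_divide norm_powr_complex powr_minus exp_minus field_simps)
  also have "\<dots> \<le> (?B powr norm s * x powr (- Re s)) * exp (pi * norm s)"
    using mod arg by (intro mult_mono) auto
  finally show ?thesis by (simp add: mult_ac)
qed

lemma summable_lerch_majorant:
  fixes \<rho> \<sigma> :: real
  assumes "0 \<le> \<rho>" "\<rho> < 1 \<or> \<rho> \<le> 1 \<and> \<sigma> > 1"
  shows "summable (\<lambda>j. \<rho> ^ j * real j powr (- \<sigma>))"
proof (cases "\<rho> = 0 \<or> \<rho> = 1")
  case True
  then show ?thesis
  proof
    assume "\<rho> = 0"
    then show ?thesis by (intro summable_finite[of "{0}"]) auto
  next
    assume "\<rho> = 1"
    then show ?thesis using assms by (simp add: summable_real_powr_iff)
  qed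
next
  case False
  then have "0 < \<rho>" "\<rho> < 1" using assms by auto
  then have "(\<lambda>j. \<rho> ^ j * real j powr (- \<sigma>)) \<in> O(\<lambda>j. real j powr (-2))"
    by real_asymp
  then show ?thesis
    by (rule summable_comparison_test_bigo[rotated]) (simp add: summable_real_powr_iff)
qed

text \<open>
Uniformity in all three variables at once is what makes this the common source of summability,
joint continuity, holomorphy in the exponent and termwise integration.
\<close>

lemma uniform_limit_lerch_series:
  fixes \<rho> \<sigma> T B :: real
  assumes "0 \<le> \<rho>" "\<rho> < 1 \<or> \<rho> \<le> 1 \<and> \<sigma> > 1"
  shows "uniform_limit {(z, s, v). norm z \<le> \<rho> \<and> \<sigma> \<le> Re s \<and> norm s \<le> T \<and> 0 < Re v \<and> norm v \<le> B}
           (\<lambda>n (z, s, v). \<Sum>j<n. z ^ j / (of_nat j + v) powr s)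
           (\<lambda>(z, s, v). lerch_series z s v) sequentially"
proof -
  let ?A = "{(z, s, v). norm z \<le> \<rho> \<and> \<sigma> \<le> Re s \<and> norm s \<le> T \<and> 0 < Re v \<and> norm v \<le> B}"
  let ?C = "exp (pi * T) * (2 + 2 * B) powr T"
  let ?f = "\<lambda>j (z, s, v). z ^ j / (of_nat j + v) powr s :: complex"
  have "norm (?f j x) \<le> ?C * (\<rho> ^ j * real j powr (- \<sigma>))" if "j \<ge> 1" "x \<in> ?A" for j x
  proof -
    obtain z s v where x: "x = (z, s, v)" by (cases x)
    have *: "norm z \<le> \<rho>" "\<sigma> \<le> Re s" "norm s \<le> T" "0 < Re v" "norm v \<le> B"
      using that x by auto
    have "real j / 2 \<le> Re (of_real (real j) + v)" using * by simp
    also have "\<dots> \<le> norm (of_real (real j) + v)" by (rule complex_Re_le_cmod)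
    finally have "norm (1 / (of_real (real j) + v) powr s)
           \<le> exp (pi * norm s) * (2 + 2 * norm v) powr norm s * real j powr (- Re s)"
      using that by (intro norm_inverse_powr_shift_le) auto
    also have "\<dots> \<le> exp (pi * T) * (2 + 2 * B) powr T * real j powr (- \<sigma>)"
    proof (intro mult_mono)
      have "(2 + 2 * norm v) powr norm s \<le> (2 + 2 * norm v) powr T"
        using * by (intro powr_mono) (auto simp: add_increasing2)
      also have "\<dots> \<le> (2 + 2 * B) powr T"
        using * norm_ge_zero[of s] by (intro powr_mono2) (linarith | simp)+
      finally show "(2 + 2 * norm v) powr norm s \<le> (2 + 2 * B) powr T" .
      show "real j powr (- Re s) \<le> real j powr (- \<sigma>)"
        using * that by (intro powr_mono) auto
    qed (use * in auto)
    finally have "norm z ^ j * norm (1 / (of_real (real j) + v) powr s)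
        \<le> \<rho> ^ j * (?C * real j powr (- \<sigma>))"
      using * assms by (intro mult_mono power_mono) auto
    then show ?thesis using x by (simp add: norm_divide norm_mult norm_power mult_ac)
  qed
  then have "eventually (\<lambda>j. \<forall>x\<in>?A. norm (?f j x) \<le> ?C * (\<rho> ^ j * real j powr (- \<sigma>))) sequentially"
    unfolding eventually_sequentially by blast
  then have "uniform_limit ?A (\<lambda>n x. \<Sum>j<n. ?f j x) (\<lambda>x. suminf (\<lambda>j. ?f j x)) sequentially"
    by (rule Weierstrass_m_test_ev) (rule summable_mult, rule summable_lerch_majorant, fact+)
  also have "?this \<longleftrightarrow> ?thesis"
    by (intro uniform_limit_cong always_eventually) (auto simp: lerch_series_def)
  finally show ?thesis .
qed

text \<open>
Removing initial terms moves \<open>v\<close> to the right. This is how facts proved for large \<open>Re v\<close> are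
transported to every \<open>v\<close>.
\<close>

lemma lerch_series_split:
  assumes "norm z < 1 \<or> norm z \<le> 1 \<and> Re s > 1"
  shows "lerch_series z s v
           = (\<Sum>j<K. z ^ j / (of_nat j + v) powr s) + z ^ K * lerch_series z s (v + of_nat K)"
    and "summable (\<lambda>j. z ^ j / (of_nat j + v) powr s)"
proof -
  have pos: "summable (\<lambda>j. z ^ j / (of_nat j + v) powr s)" if "Re v > 0" for v
  proof -
    have "uniform_limit {(z', s', v'). norm z' \<le> norm z \<and> Re s \<le> Re s' \<and> norm s' \<le> norm s
              \<and> 0 < Re v' \<and> norm v' \<le> norm v}
           (\<lambda>n (z, s, v). \<Sum>j<n. z ^ j / (of_nat j + v) powr s)
           (\<lambda>(z, s, v). lerch_series z s v) sequentially"
      using assms by (intro uniform_limit_lerch_series) auto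
    from tendsto_uniform_limitI[OF this, of "(z, s, v)"]
    have "(\<lambda>j. z ^ j / (of_nat j + v) powr s) sums lerch_series z s v"
      using that by (simp add: sums_def)
    then show ?thesis by (simp add: sums_iff)
  qed
  have shift: "(\<lambda>j. z ^ (j + K) / (of_nat (j + K) + v) powr s)
      = (\<lambda>j. z ^ K * (z ^ j / (of_nat j + (v + of_nat K)) powr s))" for K
    by (simp add: power_add mult_ac add_ac)
  \<comment> \<open>The uniform estimate needs \<open>Re v > 0\<close>, which holds after a shift of the index.\<close>
  obtain N :: nat where "- Re v < real N"
    using reals_Archimedean2 by blast
  then have N: "Re v + real N > 0" by simp
  have "summable (\<lambda>j. z ^ N * (z ^ j / (of_nat j + (v + of_nat N)) powr s))"
    using pos[of "v + of_nat N"] N by (intro summable_mult) simp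
  then have "summable (\<lambda>j. z ^ (j + N) / (of_nat (j + N) + v) powr s)" unfolding shift .
  then show sm: "summable (\<lambda>j. z ^ j / (of_nat j + v) powr s)"
    using summable_iff_shift[of "\<lambda>j. z ^ j / (of_nat j + v) powr s" N] by simp
  have "summable (\<lambda>j. z ^ (j + K) / (of_nat (j + K) + v) powr s)"
    using sm summable_iff_shift[of "\<lambda>j. z ^ j / (of_nat j + v) powr s" K] by simp
  have *: "z ^ K * lerch_series z s (v + of_nat K) = (\<Sum>j. z ^ (j + K) / (of_nat (j + K) + v) powr s)"
  proof (cases "z = 0 \<and> K > 0")
    case False
    then have "z ^ K \<noteq> 0" by (cases K) auto
    then have "summable (\<lambda>j. z ^ j / (of_nat j + (v + of_nat K)) powr s)"
      using \<open>summable (\<lambda>j. z ^ (j + K) / (of_nat (j + K) + v) powr s)\<close>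
      unfolding shift summable_cmult_iff by blast
    then show ?thesis unfolding shift lerch_series_def by (rule suminf_mult[symmetric])
  qed (auto simp: power_0_left)
  show "lerch_series z s v
      = (\<Sum>j<K. z ^ j / (of_nat j + v) powr s) + z ^ K * lerch_series z s (v + of_nat K)"
    unfolding * unfolding lerch_series_def using suminf_split_initial_segment[OF sm, of K]
    by simp
qed

text \<open>
The index \<open>l N + t\<close> contributes \<open>l N + t + N v = N (l + (v + t / N))\<close>, and the positive factor \<open>N\<close>
can be taken out of the principal power.
\<close>

lemma lerch_series_distribution:
  assumes "N > 0" and "norm w < 1 \<or> norm w \<le> 1 \<and> Re s > 1"
  shows "of_nat N powr s * lerch_series w s (of_nat N * v)
           = (\<Sum>t<N. w ^ t * lerch_series (w ^ N) s (v + of_nat t / of_nat N))"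
proof -
  have wN: "norm (w ^ N) < 1 \<or> norm (w ^ N) \<le> 1 \<and> Re s > 1"
    using assms by (auto simp: norm_power power_less_one_iff power_le_one)
  let ?f = "\<lambda>j. w ^ j / (of_nat j + of_nat N * v) powr s"
  let ?g = "\<lambda>t l. (w ^ N) ^ l / (of_nat l + (v + of_nat t / of_nat N)) powr s"
  have summand: "of_nat N powr s * ?f (l * N + t) = w ^ t * ?g t l" for l t
  proof -
    have "of_nat (l * N + t) + of_nat N * v = (of_nat N :: complex) * (of_nat l + (v + of_nat t / of_nat N))"
      using assms by (simp add: field_simps)
    then have "(of_nat (l * N + t) + of_nat N * v) powr s
        = of_nat N powr s * (of_nat l + (v + of_nat t / of_nat N)) powr s"
      by (simp add: powr_times_real_left)
    moreover have "of_nat N powr s \<noteq> (0::complex)" using assms by simp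
    moreover have "w ^ (l * N + t) = w ^ t * (w ^ N) ^ l"
      by (simp add: power_add flip: power_mult) (simp add: mult.commute)
    ultimately show ?thesis by simp
  qed
  have "?f sums lerch_series w s (of_nat N * v)"
    using lerch_series_split(2)[OF assms(2)] by (simp add: lerch_series_def summable_sums)
  from sums_group[OF this \<open>N > 0\<close>]
  have "(\<lambda>l. \<Sum>j\<in>{l * N..<l * N + N}. ?f j) sums lerch_series w s (of_nat N * v)" .
  moreover have "(\<Sum>j\<in>{l * N..<l * N + N}. ?f j) = (\<Sum>t<N. ?f (l * N + t))" for l
    by (rule sum.reindex_bij_witness[of _ "\<lambda>t. l * N + t" "\<lambda>j. j - l * N"]) auto
  ultimately have "(\<lambda>l. \<Sum>t<N. ?f (l * N + t)) sums lerch_series w s (of_nat N * v)" by simp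
  from sums_mult[OF this, of "of_nat N powr s"]
  have "(\<lambda>l. \<Sum>t<N. w ^ t * ?g t l) sums (of_nat N powr s * lerch_series w s (of_nat N * v))"
    by (simp only: sum_distrib_left summand)
  moreover have "(\<lambda>l. \<Sum>t<N. w ^ t * ?g t l)
      sums (\<Sum>t<N. w ^ t * lerch_series (w ^ N) s (v + of_nat t / of_nat N))"
    using lerch_series_split(2)[OF wN]
    by (intro sums_sum sums_mult) (simp add: lerch_series_def summable_sums)
  ultimately show ?thesis by (rule sums_unique2)
qed

section \<open>Holomorphic parameter integrals\<close>

lemma continuous_on_uncurried_compose:
  assumes cont: "continuous_on (U \<times> T) (\<lambda>(x, t). f x t)"
    and "continuous_on S a" "continuous_on S b"
    and "\<And>p. p \<in> S \<Longrightarrow> a p \<in> U" "\<And>p. p \<in> S \<Longrightarrow> b p \<in> T"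
  shows "continuous_on S (\<lambda>p. f (a p) (b p))"
proof -
  have "continuous_on S (\<lambda>p. (a p, b p))" using assms by (intro continuous_on_Pair)
  moreover have "(\<lambda>p. (a p, b p)) ` S \<subseteq> U \<times> T" using assms by auto
  ultimately have "continuous_on S (\<lambda>p. (\<lambda>(x, t). f x t) (a p, b p))"
    by (rule continuous_on_compose2[OF cont])
  then show ?thesis by simp
qed

text \<open>
By joint continuity the integral over \<open>t\<close> can be exchanged with the integral around a triangle,
where Cauchy's theorem gives zero for each \<open>t\<close>; Morera's theorem concludes. The parameter interval is
regarded as the complex segment from \<open>0\<close> to \<open>1\<close>, so that the exchange is one of contour integrals.
\<close>

lemma holomorphic_on_parameter_integral:
  fixes f :: "complex \<Rightarrow> real \<Rightarrow> complex"
  assumes "open U" and cont: "continuous_on (U \<times> {0..1}) (\<lambda>(x, t). f x t)"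
    and hol: "\<And>t. t \<in> {0..1} \<Longrightarrow> (\<lambda>x. f x t) holomorphic_on U"
  shows "(\<lambda>x. integral {0..1} (f x)) holomorphic_on U"
proof -
  let ?F = "\<lambda>x. integral {0..1} (f x)"
  let ?p = "linepath 0 1 :: real \<Rightarrow> complex"
  have F: "contour_integral ?p (\<lambda>t. f x (Re t)) = ?F x" for x
    unfolding contour_integral_integral vector_derivative_linepath_at
    by (rule integral_cong) (simp add: linepath_def)
  have contF: "continuous_on U ?F"
    using integral_continuous_on_param[of U 0 1 f] cont by simp
  have "?F analytic_on U"
  proof (rule Morera_triangle[OF contF \<open>open U\<close>], intro impI)
    fix a b c assume abc: "convex hull {a, b, c} \<subseteq> U"
    have swap: "contour_integral (linepath x y) ?F
        = contour_integral ?p (\<lambda>t. contour_integral (linepath x y) (\<lambda>w. f w (Re t)))"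
      if "closed_segment x y \<subseteq> U" for x y
    proof -
      have "continuous_on (closed_segment x y \<times> closed_segment 0 1) (\<lambda>(w, t). f w (Re t))"
      proof -
        have "continuous_on (closed_segment x y \<times> closed_segment 0 1) (\<lambda>p. f (fst p) (Re (snd p)))"
        proof (rule continuous_on_uncurried_compose[OF cont])
          show "continuous_on (closed_segment x y \<times> closed_segment 0 1) (\<lambda>p. Re (snd p))"
            by (intro continuous_intros)
        qed (use that in \<open>auto simp: closed_segment_def[of 0 1] intro: continuous_intros\<close>)
        then show ?thesis by (simp add: case_prod_unfold)
      qed
      then have "contour_integral (linepath x y) (\<lambda>w. contour_integral ?p (\<lambda>t. f w (Re t)))
        = contour_integral ?p (\<lambda>t. contour_integral (linepath x y) (\<lambda>w. f w (Re t)))"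
        by (intro contour_integral_swap) auto
      then show ?thesis by (simp add: F)
    qed
    have seg: "closed_segment a b \<subseteq> U" "closed_segment b c \<subseteq> U" "closed_segment c a \<subseteq> U"
      by (rule order_trans[OF _ abc], rule segments_subset_convex_hull)+
    have int: "(\<lambda>t. contour_integral (linepath x y) (\<lambda>w. f w (Re t))) contour_integrable_on ?p"
      if "closed_segment x y \<subseteq> U" for x y
    proof (rule contour_integrable_continuous_linepath)
      have *: "contour_integral (linepath x y) (\<lambda>w. f w (Re t))
          = integral (cbox 0 1) (\<lambda>r. f (linepath x y r) (Re t) * (y - x))" for t
        unfolding contour_integral_integral vector_derivative_linepath_at by simp
      have "continuous_on (closed_segment 0 1 \<times> cbox 0 1) (\<lambda>p. f (linepath x y (snd p)) (Re (fst p)))"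
      proof (rule continuous_on_uncurried_compose[OF cont])
        show "continuous_on (closed_segment 0 1 \<times> cbox 0 1) (\<lambda>p. linepath x y (snd p))"
          unfolding linepath_def by (intro continuous_intros)
        show "continuous_on (closed_segment 0 1 \<times> cbox 0 1) (\<lambda>p. Re (fst p))"
          by (intro continuous_intros)
        fix p :: "complex \<times> real" assume p: "p \<in> closed_segment 0 1 \<times> cbox 0 1"
        then have "snd p \<in> {0..1}" by auto
        from linepath_in_path[OF this] show "linepath x y (snd p) \<in> U" using that by blast
        show "Re (fst p) \<in> {0..1}" using p by (auto simp: closed_segment_def)
      qed
      then have "continuous_on (closed_segment 0 1 \<times> cbox 0 1)
          (\<lambda>p. f (linepath x y (snd p)) (Re (fst p)) * (y - x))"
        by (rule continuous_on_mult_right)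
      then show "continuous_on (closed_segment 0 1) (\<lambda>t. contour_integral (linepath x y) (\<lambda>w. f w (Re t)))"
        unfolding * by (intro integral_continuous_on_param) (simp add: case_prod_unfold)
    qed
    have "contour_integral (linepath a b) (\<lambda>w. f w r) + contour_integral (linepath b c) (\<lambda>w. f w r)
        + contour_integral (linepath c a) (\<lambda>w. f w r) = 0" if "r \<in> {0..1}" for r
    proof -
      have "(\<lambda>w. f w r) holomorphic_on convex hull {a, b, c}"
        using hol[OF that] abc by (rule holomorphic_on_subset)
      then have "((\<lambda>w. f w r) has_contour_integral 0) (linepath a b +++ linepath b c +++ linepath c a)"
        by (rule Cauchy_theorem_triangle)
      then show ?thesis by (rule has_chain_integral_chain_integral3)
    qed
    note zero = this
    have "contour_integral (linepath a b) ?F + contour_integral (linepath b c) ?F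
          + contour_integral (linepath c a) ?F
        = contour_integral ?p (\<lambda>t. contour_integral (linepath a b) (\<lambda>w. f w (Re t))
          + contour_integral (linepath b c) (\<lambda>w. f w (Re t)) + contour_integral (linepath c a) (\<lambda>w. f w (Re t)))"
      unfolding swap[OF seg(1)] swap[OF seg(2)] swap[OF seg(3)]
      using int[OF seg(1)] int[OF seg(2)] int[OF seg(3)]
      by (simp only: contour_integral_add contour_integrable_add)
    also have "\<dots> = contour_integral ?p (\<lambda>t. 0)"
    proof (intro contour_integral_cong refl)
      fix t :: complex assume "t \<in> path_image ?p"
      then have "Re t \<in> {0..1}" by (auto simp: closed_segment_def)
      then show "contour_integral (linepath a b) (\<lambda>w. f w (Re t))
          + contour_integral (linepath b c) (\<lambda>w. f w (Re t))
          + contour_integral (linepath c a) (\<lambda>w. f w (Re t)) = 0" by (rule zero)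
    qed
    finally show "contour_integral (linepath a b) ?F + contour_integral (linepath b c) ?F
        + contour_integral (linepath c a) ?F = 0" by simp
  qed
  then show ?thesis by (rule analytic_imp_holomorphic)
qed

section \<open>Continuation in the exponent\<close>

lemma of_nat_add_neq_0:
  fixes v :: complex
  assumes "Re v > 0"
  shows "of_nat j + v \<noteq> 0"
  using assms by (auto simp: complex_eq_iff)

lemma lerch_series_continuous_on:
  "continuous_on (cball 0 1 \<times> {s. Re s > 1} \<times> {v. Re v > 0}) (\<lambda>(z, s, v). lerch_series z s v)"
  unfolding continuous_on_eq_continuous_within
proof (rule ballI)
  let ?A = "cball 0 1 \<times> {s. Re s > 1} \<times> {v. Re v > 0} :: (complex \<times> complex \<times> complex) set"
  fix p assume "p \<in> ?A"
  moreover obtain z0 s0 v0 where p: "p = (z0, s0, v0)" by (cases p)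
  ultimately have in_dom: "(z0, s0, v0) \<in> ?A" by simp
  \<comment> \<open>Near the given point the exponents stay to the right of some \<open>\<sigma> > 1\<close> and all variables are bounded.\<close>
  define \<sigma> T B where "\<sigma> = (1 + Re s0) / 2" and "T = norm s0 + 1" and "B = norm v0 + 1"
  let ?W = "{p. \<sigma> < Re (fst (snd p))} \<inter> {p. norm (fst (snd p)) < T} \<inter> {p. norm (snd (snd p)) < B}
              :: (complex \<times> complex \<times> complex) set"
  have W: "open ?W" "(z0, s0, v0) \<in> ?W"
    using in_dom by (auto intro!: open_Int open_Collect_less continuous_intros simp: \<sigma>_def T_def B_def)
  have "uniform_limit {(z, s, v). norm z \<le> 1 \<and> \<sigma> \<le> Re s \<and> norm s \<le> T \<and> 0 < Re v \<and> norm v \<le> B}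
           (\<lambda>n (z, s, v). \<Sum>j<n. z ^ j / (of_nat j + v) powr s)
           (\<lambda>(z, s, v). lerch_series z s v) sequentially"
    using in_dom by (intro uniform_limit_lerch_series) (auto simp: \<sigma>_def)
  then have ul: "uniform_limit (?A \<inter> ?W)
           (\<lambda>n (z, s, v). \<Sum>j<n. z ^ j / (of_nat j + v) powr s)
           (\<lambda>(z, s, v). lerch_series z s v) sequentially"
    by (rule uniform_limit_on_subset) auto
  have "continuous_on (?A \<inter> ?W) (\<lambda>(z, s, v). \<Sum>j<n. z ^ j / (of_nat j + v) powr s)" for n
    unfolding case_prod_unfold by (intro continuous_intros) (auto simp: of_nat_add_neq_0)
  then have "continuous_on (?A \<inter> ?W) (\<lambda>(z, s, v). lerch_series z s v)"
    by (intro uniform_limit_theorem[OF always_eventually ul]) auto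
  then have "continuous (at (z0, s0, v0) within ?A \<inter> ?W) (\<lambda>(z, s, v). lerch_series z s v)"
    using in_dom W(2) unfolding continuous_on_eq_continuous_within by blast
  moreover have "at (z0, s0, v0) within ?A \<inter> ?W = at (z0, s0, v0) within ?A"
    using W by (intro at_within_nhd[of _ ?W]) auto
  ultimately show "continuous (at p within ?A) (\<lambda>(z, s, v). lerch_series z s v)"
    by (simp add: p)
qed

lemma lerch_series_holomorphic_in_exponent:
  assumes "norm z \<le> 1" "Re v > 0"
  shows "(\<lambda>s. lerch_series z s v) holomorphic_on {s. Re s > 1}"
proof (rule holomorphic_uniform_sequence[where f = "\<lambda>n s. \<Sum>j<n. z ^ j / (of_nat j + v) powr s"])
  show "open {s. Re s > 1}" by (rule open_halfspace_Re_gt)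
  have "of_nat j + v \<noteq> 0" for j using assms by (intro of_nat_add_neq_0)
  then show "(\<lambda>s. \<Sum>j<n. z ^ j / (of_nat j + v) powr s) holomorphic_on {s. Re s > 1}" for n
    by (intro holomorphic_intros) auto
  fix s0 :: complex assume s0: "s0 \<in> {s. Re s > 1}"
  define d where "d = (Re s0 - 1) / 2"
  have Re: "1 + d \<le> Re s" if "s \<in> cball s0 d" for s
    using that abs_Re_le_cmod[of "s0 - s"] by (simp add: dist_norm d_def) (simp add: abs_le_iff field_simps)
  have nrm: "norm s \<le> norm s0 + d" if "s \<in> cball s0 d" for s
    using that norm_triangle_sub[of s s0] by (simp add: dist_norm norm_minus_commute)
  have d: "d > 0" using s0 by (simp add: d_def)
  have "uniform_limit {(z', s', v'). norm z' \<le> 1 \<and> 1 + d \<le> Re s' \<and> norm s' \<le> norm s0 + d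
            \<and> 0 < Re v' \<and> norm v' \<le> norm v}
           (\<lambda>n (z, s, v). \<Sum>j<n. z ^ j / (of_nat j + v) powr s)
           (\<lambda>(z, s, v). lerch_series z s v) sequentially"
    using d by (intro uniform_limit_lerch_series) auto
  then have "uniform_limit (cball s0 d)
           (\<lambda>n s. (\<lambda>(z, s, v). \<Sum>j<n. z ^ j / (of_nat j + v) powr s) (z, s, v))
           (\<lambda>s. (\<lambda>(z, s, v). lerch_series z s v) (z, s, v)) sequentially"
    by (rule uniform_limit_compose') (use assms Re nrm in auto)
  moreover have "cball s0 d \<subseteq> {s. Re s > 1}" using Re d by fastforce
  ultimately show "\<exists>d>0. cball s0 d \<subseteq> {s. Re s > 1} \<and> uniform_limit (cball s0 d)
      (\<lambda>n s. \<Sum>j<n. z ^ j / (of_nat j + v) powr s) (\<lambda>s. lerch_series z s v) sequentially"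
    using d by auto
qed

text \<open>
The weight \<open>\<phi>\<close> is constant for \<open>z \<noteq> 1\<close> and a multiple of \<open>1 - u\<close> in the Hurwitz case.
\<close>

lemma sums_integral_lerch_series:
  assumes "norm z < 1 \<or> norm z \<le> 1 \<and> Re s > 1" "Re v > 0" and \<phi>: "continuous_on {0..1} \<phi>"
  shows "(\<lambda>j. integral {0..1} (\<lambda>u. \<phi> u * (z ^ j / (of_nat j + (v + of_real u)) powr s)))
           sums integral {0..1} (\<lambda>u::real. \<phi> u * lerch_series z s (v + of_real u))"
proof -
  let ?a = "\<lambda>j u. z ^ j / (of_nat j + (v + of_real u)) powr s"
  let ?P = "\<lambda>n u::real. \<Sum>j<n. ?a j u"
  let ?L = "\<lambda>u. lerch_series z s (v + of_real u)"
  have "uniform_limit {(z', s', v'). norm z' \<le> norm z \<and> Re s \<le> Re s' \<and> norm s' \<le> norm s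
            \<and> 0 < Re v' \<and> norm v' \<le> norm v + 1}
           (\<lambda>n (z, s, v). \<Sum>j<n. z ^ j / (of_nat j + v) powr s)
           (\<lambda>(z, s, v). lerch_series z s v) sequentially"
    using assms by (intro uniform_limit_lerch_series) auto
  then have "uniform_limit {0..1}
           (\<lambda>n u. (\<lambda>(z, s, v). \<Sum>j<n. z ^ j / (of_nat j + v) powr s) (z, s, v + of_real u))
           (\<lambda>u. (\<lambda>(z, s, v). lerch_series z s v) (z, s, v + of_real u)) sequentially"
    by (rule uniform_limit_compose') (use assms in \<open>auto intro!: norm_triangle_le\<close>)
  then have ul: "uniform_limit {0..1} ?P ?L sequentially" by simp
  have nz: "of_nat j + (v + of_real u) \<noteq> 0" if "u \<in> {0..1}" for j and u :: real
    using assms that by (auto simp: complex_eq_iff)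
  have conta: "continuous_on {0..1} (?a j)" for j
    using assms by (intro continuous_intros) (auto simp: nz)
  have contP: "continuous_on {0..1} (?P n)" for n by (intro continuous_on_sum conta)
  then have "continuous_on {0..1} ?L"
    by (intro uniform_limit_theorem[OF always_eventually ul]) auto
  then have "bounded (?L ` {0..1})" "bounded (\<phi> ` {0..1})"
    using \<phi> by (intro compact_imp_bounded compact_continuous_image; simp)+
  then have "uniform_limit {0..1} (\<lambda>n u. \<phi> u * ?P n u) (\<lambda>u. \<phi> u * ?L u) sequentially"
    by (intro uniform_lim_mult uniform_limit_const ul) auto
  moreover have "continuous_on {0..1} (\<lambda>u. \<phi> u * ?P n u)" for n
    by (intro continuous_on_mult \<phi> contP)
  ultimately obtain I J where IJ: "\<And>n. ((\<lambda>u. \<phi> u * ?P n u) has_integral I n) {0..1}"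
      "((\<lambda>u. \<phi> u * ?L u) has_integral J) {0..1}" "I \<longlonglongrightarrow> J"
    by (rule uniform_limit_integral[where a = 0 and b = 1]) auto
  have "I n = (\<Sum>j<n. integral {0..1} (\<lambda>u. \<phi> u * ?a j u))" for n
  proof -
    have "I n = integral {0..1} (\<lambda>u. \<Sum>j<n. \<phi> u * ?a j u)"
      using IJ(1)[of n] by (simp add: sum_distrib_left integral_unique)
    also have "\<dots> = (\<Sum>j<n. integral {0..1} (\<lambda>u. \<phi> u * ?a j u))"
      by (intro integral_sum integrable_continuous_real continuous_on_mult \<phi> conta) auto
    finally show ?thesis .
  qed
  then have "I = (\<lambda>n. \<Sum>j<n. integral {0..1} (\<lambda>u. \<phi> u * ?a j u))" ..
  moreover have "integral {0..1} (\<lambda>u. \<phi> u * ?L u) = J" using IJ(2) by (rule integral_unique)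
  ultimately show ?thesis using IJ(3) by (simp add: sums_def)
qed

lemma has_vector_derivative_powr_shift:
  fixes a s :: complex and u :: real
  assumes "Re a > 0" "u \<in> {0..1}"
  shows "((\<lambda>u. (a + of_real u) powr s) has_vector_derivative s * (a + of_real u) powr (s - 1))
           (at u within {0..1})"
proof -
  have "a + of_real u \<notin> \<real>\<^sub>\<le>\<^sub>0"
    using assms by (auto simp: complex_nonpos_Reals_iff)
  then have "((\<lambda>x. (a + x) powr s) has_field_derivative s * (a + of_real u) powr (s - 1)) (at (of_real u))"
    by (auto intro!: derivative_eq_intros)
  then show ?thesis
    by (rule has_vector_derivative_real_field)
qed

lemma integral_powr_shift:
  fixes a s :: complex
  assumes "Re a > 0"
  shows "((\<lambda>u. s / (a + of_real u) powr (s + 1)) has_integral 1 / a powr s - 1 / (a + 1) powr s) {0..1::real}"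
proof -
  have "((\<lambda>u::real. - (- s * (a + of_real u) powr (- s - 1))) has_integral
       - ((a + of_real 1) powr (- s)) - - ((a + of_real 0) powr (- s))) {0..1}"
    by (intro fundamental_theorem_of_calculus has_vector_derivative_minus
        has_vector_derivative_powr_shift assms) auto
  moreover have "- s - 1 = - (s + 1)" by simp
  ultimately show ?thesis by (simp only: powr_minus) (simp add: divide_inverse)
qed

text \<open>
Integrating \<open>(a + u) powr - s\<close> by parts, with \<open>u - 1\<close> as primitive of \<open>1\<close>, produces the weight \<open>1 - u\<close>. The
factor \<open>s - 1\<close> clears the denominator of that integral.
\<close>

lemma integral_linear_powr_shift:
  fixes a s :: complex
  assumes "Re a > 0"
  shows "((\<lambda>u. (s - 1) * (1 - of_real u) * (s / (a + of_real u) powr (s + 1))) has_integral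
           (s - 1) / a powr s + ((a + 1) powr (1 - s) - a powr (1 - s))) {0..1::real}"
proof -
  let ?Q = "\<lambda>u::real. (a + of_real u) powr (1 - s) - (s - 1) * ((1 - of_real u) * (a + of_real u) powr (- s))"
  have "((\<lambda>u::real. (s - 1) * (1 - of_real u) * (s / (a + of_real u) powr (s + 1))) has_integral
       ?Q 1 - ?Q 0) {0..1}"
  proof (rule fundamental_theorem_of_calculus)
    fix u :: real assume u: "u \<in> {0..1}"
    have "((\<lambda>u::real. 1 - of_real u :: complex) has_vector_derivative - 1) (at u within {0..1})"
      by (auto intro!: derivative_eq_intros)
    then have "(?Q has_vector_derivative (1 - s) * (a + of_real u) powr (1 - s - 1)
        - (s - 1) * ((1 - of_real u) * (- s * (a + of_real u) powr (- s - 1))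
            + (- 1) * (a + of_real u) powr (- s))) (at u within {0..1})"
      by (intro has_vector_derivative_diff has_vector_derivative_mult_right has_vector_derivative_mult
          has_vector_derivative_powr_shift assms u)
    moreover have "(1 - s) * (a + of_real u) powr (1 - s - 1)
        - (s - 1) * ((1 - of_real u) * (- s * (a + of_real u) powr (- s - 1))
            + (- 1) * (a + of_real u) powr (- s))
        = (s - 1) * (1 - of_real u) * (s / (a + of_real u) powr (s + 1))"
    proof -
      have "(1 - s) * p - (s - 1) * (w * (- s * q) + (- 1) * p) = (s - 1) * w * (s * q)" for p q w
        by (simp add: algebra_simps)
      moreover have "x powr (- s - 1) = inverse (x powr (s + 1))" for x :: complex
        using powr_minus[of x "s + 1"] by simp
      moreover have "1 - s - 1 = - s" by simp
      ultimately show ?thesis by (simp only: divide_inverse)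
    qed
    ultimately show "(?Q has_vector_derivative (s - 1) * (1 - of_real u) * (s / (a + of_real u) powr (s + 1)))
        (at u within {0..1})"
      by (simp only:)
  qed simp
  then show ?thesis by (simp add: powr_minus divide_inverse algebra_simps)
qed

text \<open>
Since \<open>\<Phi>(z, s, v) = v powr - s + z \<Phi>(z, s, v + 1)\<close>, the product \<open>(1 - z) \<Phi>(z, s, v)\<close> is
\<open>v powr - s - z (\<Phi>(z, s, v) - \<Phi>(z, s, v + 1))\<close>, and the difference is the integral of
\<open>- \<partial>\<Phi>/\<partial>v = s \<Phi>(z, s + 1, v)\<close>. The right-hand side involves \<open>\<Phi>\<close> at exponent \<open>s + 1\<close> only.
\<close>

lemma lerch_series_integral_equation:
  assumes "norm z < 1 \<or> norm z \<le> 1 \<and> Re s > 1" "Re v > 0"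
  shows "(1 - z) * lerch_series z s v
           = 1 / v powr s - z * integral {0..1::real} (\<lambda>u. s * lerch_series z (s + 1) (v + of_real u))"
proof -
  have cond: "norm z < 1 \<or> norm z \<le> 1 \<and> Re (s + 1) > 1" using assms by auto
  have int: "integral {0..1} (\<lambda>u::real. s * (z ^ j / (of_nat j + (v + of_real u)) powr (s + 1)))
      = z ^ j / (of_nat j + v) powr s - z ^ j / (of_nat j + (v + 1)) powr s" for j
  proof -
    have "((\<lambda>u::real. z ^ j * (s / (of_nat j + v + of_real u) powr (s + 1))) has_integral
        z ^ j * (1 / (of_nat j + v) powr s - 1 / (of_nat j + v + 1) powr s)) {0..1}"
      using assms by (intro has_integral_mult_right integral_powr_shift) auto
    then show ?thesis by (intro integral_unique) (simp add: algebra_simps)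
  qed
  have "(\<lambda>j. z ^ j / (of_nat j + v) powr s - z ^ j / (of_nat j + (v + 1)) powr s)
      sums integral {0..1} (\<lambda>u::real. s * lerch_series z (s + 1) (v + of_real u))"
    using sums_integral_lerch_series[OF cond assms(2), of "\<lambda>_. s"] unfolding int by simp
  moreover have "(\<lambda>j. z ^ j / (of_nat j + v) powr s - z ^ j / (of_nat j + (v + 1)) powr s)
      sums (lerch_series z s v - lerch_series z s (v + 1))"
    unfolding lerch_series_def
    by (intro sums_diff summable_sums lerch_series_split(2) assms)
  ultimately have "integral {0..1} (\<lambda>u::real. s * lerch_series z (s + 1) (v + of_real u))
      = lerch_series z s v - lerch_series z s (v + 1)"
    by (rule sums_unique2)
  moreover have "lerch_series z s v = 1 / v powr s + z * lerch_series z s (v + 1)"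
    using lerch_series_split(1)[OF assms(1), of v 1] by simp
  moreover have "(1 - z) * lerch_series z s v = (lerch_series z s v - z * lerch_series z s (v + 1))
      - z * (lerch_series z s v - lerch_series z s (v + 1))"
    by (simp add: algebra_simps)
  ultimately show ?thesis by (metis add_diff_cancel_right')
qed

text \<open>
For \<open>z = 1\<close> the factor \<open>1 - z\<close> of the previous equation vanishes; instead \<open>\<zeta>(s, v)\<close> is compared with its mean
\<open>\<integral> \<zeta>(s, v + u) du = v powr (1 - s) / (s - 1)\<close> over \<open>u\<close> in the unit interval. In terms of \<open>(s - 1) \<zeta>(s, v)\<close> the equation has no pole:
the factor \<open>s\<close> in the integrand is \<open>(s + 1) - 1\<close>.
\<close>

lemma hurwitz_series_integral_equation:
  assumes "Re s > 1" "Re v > 0"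
  shows "(s - 1) * lerch_series 1 s v = v powr (1 - s)
           + (s - 1) * integral {0..1::real} (\<lambda>u. (1 - of_real u) * (s * lerch_series 1 (s + 1) (v + of_real u)))"
proof -
  have cond: "norm (1::complex) < 1 \<or> norm (1::complex) \<le> 1 \<and> Re s > 1" using assms by auto
  have cond': "norm (1::complex) < 1 \<or> norm (1::complex) \<le> 1 \<and> Re (s + 1) > 1" using assms by auto
  let ?b = "\<lambda>j. (of_nat j + v) powr (1 - s)"
  have int: "integral {0..1} (\<lambda>u::real. (s - 1) * (1 - of_real u) * s
        * (1 ^ j / (of_nat j + (v + of_real u)) powr (s + 1)))
      = (s - 1) * (1 ^ j / (of_nat j + v) powr s) + (?b (Suc j) - ?b j)" for j
  proof -
    have "((\<lambda>u::real. (s - 1) * (1 - of_real u) * (s / (of_nat j + v + of_real u) powr (s + 1))) has_integral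
        (s - 1) / (of_nat j + v) powr s + ((of_nat j + v + 1) powr (1 - s) - (of_nat j + v) powr (1 - s))) {0..1}"
      using assms by (intro integral_linear_powr_shift) auto
    then show ?thesis by (intro integral_unique) (simp add: add_ac mult_ac)
  qed
  have "(\<lambda>j. (s - 1) * (1 ^ j / (of_nat j + v) powr s) + (?b (Suc j) - ?b j)) sums
      integral {0..1} (\<lambda>u::real. (s - 1) * (1 - of_real u) * s * lerch_series 1 (s + 1) (v + of_real u))"
    using sums_integral_lerch_series[OF cond' assms(2), of "\<lambda>u. (s - 1) * (1 - of_real u) * s"]
    unfolding int by (simp add: continuous_intros)
  moreover have "(\<lambda>j. (s - 1) * (1 ^ j / (of_nat j + v) powr s) + (?b (Suc j) - ?b j)) sums
      ((s - 1) * lerch_series 1 s v + (0 - ?b 0))"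
  proof (intro sums_add sums_mult telescope_sums)
    show "(\<lambda>j. 1 ^ j / (of_nat j + v) powr s) sums lerch_series 1 s v"
      unfolding lerch_series_def by (intro summable_sums lerch_series_split(2) cond)
    let ?C = "exp (pi * norm (s - 1)) * (2 + 2 * norm v) powr norm (s - 1)"
    have "norm (?b j) \<le> ?C * real j powr (1 - Re s)" if "j \<ge> 1" for j
    proof -
      have "real j / 2 \<le> Re (of_real (real j) + v)" using assms by simp
      also have "\<dots> \<le> norm (of_real (real j) + v)" by (rule complex_Re_le_cmod)
      finally have "norm (1 / (of_real (real j) + v) powr (s - 1)) \<le> ?C * real j powr (- Re (s - 1))"
        using that by (intro norm_inverse_powr_shift_le) auto
      then show ?thesis using powr_minus[of "of_nat j + v" "s - 1"] by (simp add: divide_inverse)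
    qed
    then have "\<forall>\<^sub>F j in sequentially. norm (?b j) \<le> ?C * real j powr (1 - Re s)"
      unfolding eventually_sequentially by blast
    moreover have "(\<lambda>j. ?C * real j powr (1 - Re s)) \<longlonglongrightarrow> 0"
      using assms by real_asymp
    ultimately show "?b \<longlonglongrightarrow> 0" by (rule Lim_null_comparison)
  qed
  ultimately have "integral {0..1} (\<lambda>u::real. (s - 1) * (1 - of_real u) * s * lerch_series 1 (s + 1) (v + of_real u))
      = (s - 1) * lerch_series 1 s v - v powr (1 - s)"
    by (auto dest: sums_unique2)
  then show ?thesis
    by (simp add: mult.assoc)
qed

text \<open>
The induction step shared by both continuations. Evaluating \<open>G\<close> at \<open>s + 1\<close> gains a strip of width
one. Joint continuity has to be part of the invariant: it is what makes the integral over \<open>u\<close>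
holomorphic in \<open>s\<close>.
\<close>

lemma shifted_integral_continuous_holomorphic:
  fixes G :: "complex \<Rightarrow> complex \<Rightarrow> complex \<Rightarrow> complex" and \<phi> :: "real \<Rightarrow> complex"
  assumes cont: "continuous_on (Z \<times> {s. Re s > c} \<times> {v. Re v > 0}) (\<lambda>(z, s, v). G z s v)"
    and hol: "\<And>z v. z \<in> Z \<Longrightarrow> Re v > 0 \<Longrightarrow> (\<lambda>s. G z s v) holomorphic_on {s. Re s > c}"
    and \<phi>: "continuous_on {0..1} \<phi>"
  defines "I \<equiv> \<lambda>z s v. integral {0..1} (\<lambda>u. \<phi> u * G z (s + 1) (v + of_real u))"
  shows "continuous_on (Z \<times> {s. Re s > c - 1} \<times> {v. Re v > 0}) (\<lambda>(z, s, v). I z s v)"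
    and "\<And>z v. z \<in> Z \<Longrightarrow> Re v > 0 \<Longrightarrow> (\<lambda>s. I z s v) holomorphic_on {s. Re s > c - 1}"
proof -
  let ?D = "Z \<times> {s. Re s > c - 1} \<times> {v. Re v > (0::real)}"
  let ?g = "\<lambda>q :: (complex \<times> complex \<times> complex) \<times> real.
      (fst (fst q), fst (snd (fst q)) + 1, snd (snd (fst q)) + of_real (snd q))"
  have "continuous_on (?D \<times> {0..1}) ?g" by (intro continuous_intros)
  moreover have "?g ` (?D \<times> {0..1}) \<subseteq> Z \<times> {s. Re s > c} \<times> {v. Re v > 0}" by auto
  ultimately have G: "continuous_on (?D \<times> {0..1}) (\<lambda>q. (\<lambda>(z, s, v). G z s v) (?g q))"
    by (rule continuous_on_compose2[OF cont])
  have \<phi>': "continuous_on (?D \<times> {0..1}) (\<lambda>q. \<phi> (snd q))"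
    by (intro continuous_on_compose2[OF \<phi>] continuous_intros) auto
  have GG: "continuous_on (?D \<times> {0..1}) (\<lambda>(p, u). \<phi> u * G (fst p) (fst (snd p) + 1) (snd (snd p) + of_real u))"
    using continuous_on_mult[OF \<phi>' G] by (simp add: case_prod_unfold)
  show "continuous_on ?D (\<lambda>(z, s, v). I z s v)"
    using integral_continuous_on_param[of ?D 0 1 "\<lambda>p u. \<phi> u * G (fst p) (fst (snd p) + 1) (snd (snd p) + of_real u)"] GG
    by (simp add: I_def case_prod_unfold)
  fix z v assume zv: "z \<in> Z" "Re v > 0"
  show "(\<lambda>s. I z s v) holomorphic_on {s. Re s > c - 1}"
    unfolding I_def
  proof (rule holomorphic_on_parameter_integral)
    show "open {s. c - 1 < Re s}" by (rule open_halfspace_Re_gt)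
    have "continuous_on ({s. c - 1 < Re s} \<times> {0..1}) (\<lambda>q. ((z, fst q, v), snd q))"
      by (intro continuous_intros)
    moreover have "(\<lambda>q. ((z, fst q, v), snd q)) ` ({s. c - 1 < Re s} \<times> {0..1}) \<subseteq> ?D \<times> {0..1}"
      using zv by auto
    ultimately have "continuous_on ({s. c - 1 < Re s} \<times> {0..1}) (\<lambda>q. (\<lambda>(p, u).
        \<phi> u * G (fst p) (fst (snd p) + 1) (snd (snd p) + of_real u)) ((z, fst q, v), snd q))"
      by (rule continuous_on_compose2[OF GG])
    then show "continuous_on ({s. c - 1 < Re s} \<times> {0..1}) (\<lambda>(s, u). \<phi> u * G z (s + 1) (v + of_real u))"
      by (simp add: case_prod_unfold)
    fix u :: real assume "u \<in> {0..1}"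
    then have "(\<lambda>s. G z s (v + of_real u)) holomorphic_on {s. Re s > c}"
      using zv by (intro hol) auto
    then have "((\<lambda>s. G z s (v + of_real u)) \<circ> (\<lambda>s. s + 1)) holomorphic_on {s. c - 1 < Re s}"
      by (intro holomorphic_on_compose_gen[of _ _ _ "{s. Re s > c}"] holomorphic_intros) auto
    then show "(\<lambda>s. \<phi> u * G z (s + 1) (v + of_real u)) holomorphic_on {s. c - 1 < Re s}"
      by (intro holomorphic_intros) (simp add: o_def)
  qed
qed

text \<open>
The point \<open>z = 1\<close> is excluded because the integral equation is divided by \<open>1 - z\<close>. Treating the disc
together with its boundary matters: inside the disc \<open>G\<close> is the series for every exponent, on the
boundary only for \<open>Re s > 1\<close>, and continuity in \<open>z\<close> links the two.
\<close>

lemma lerch_series_continuation_right_half_plane: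
  "\<exists>G. continuous_on ((cball 0 1 - {1}) \<times> {s. Re s > 1 - real M} \<times> {v. Re v > 0}) (\<lambda>(z, s, v). G z s v)
     \<and> (\<forall>z\<in>cball 0 1 - {1}. \<forall>v. Re v > 0 \<longrightarrow> (\<lambda>s. G z s v) holomorphic_on {s. Re s > 1 - real M})
     \<and> (\<forall>z\<in>cball 0 1 - {1}. \<forall>s v. Re s > 1 - real M \<longrightarrow> Re v > 0 \<longrightarrow> norm z < 1 \<or> Re s > 1
          \<longrightarrow> G z s v = lerch_series z s v)"
proof (induction M)
  case 0
  show ?case
  proof (intro exI[of _ lerch_series] conjI ballI allI impI)
    show "continuous_on ((cball 0 1 - {1}) \<times> {s. Re s > 1 - real 0} \<times> {v. Re v > 0})
        (\<lambda>(z, s, v). lerch_series z s v)"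
      by (rule continuous_on_subset[OF lerch_series_continuous_on]) auto
    show "(\<lambda>s. lerch_series z s v) holomorphic_on {s. Re s > 1 - real 0}"
      if "z \<in> cball 0 1 - {1}" "Re v > 0" for z v
      using lerch_series_holomorphic_in_exponent[of z v] that by simp
  qed simp
next
  case (Suc M)
  then obtain G where
      G1: "continuous_on ((cball 0 1 - {1}) \<times> {s. Re s > 1 - real M} \<times> {v. Re v > 0}) (\<lambda>(z, s, v). G z s v)"
    and G2': "\<forall>z\<in>cball 0 1 - {1}. \<forall>v. Re v > 0 \<longrightarrow> (\<lambda>s. G z s v) holomorphic_on {s. Re s > 1 - real M}"
    and G3': "\<forall>z\<in>cball 0 1 - {1}. \<forall>s v. Re s > 1 - real M \<longrightarrow> Re v > 0 \<longrightarrow> norm z < 1 \<or> Re s > 1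
        \<longrightarrow> G z s v = lerch_series z s v"
    by (elim exE conjE) (rule that)
  have G2: "(\<lambda>s. G z s v) holomorphic_on {s. Re s > 1 - real M}" if "z \<in> cball 0 1 - {1}" "Re v > 0" for z v
    using G2' that by blast
  have G3: "G z s v = lerch_series z s v"
    if "z \<in> cball 0 1 - {1}" "Re s > 1 - real M" "Re v > 0" "norm z < 1 \<or> Re s > 1" for z s v
    using bspec[OF G3' that(1)] that(2-) by blast
  let ?I = "\<lambda>z s v. integral {0..1} (\<lambda>u::real. 1 * G z (s + 1) (v + of_real u))"
  let ?H = "\<lambda>z s v. (1 / v powr s - z * (s * ?I z s v)) / (1 - z)"
  have M: "1 - real M - 1 = 1 - real (Suc M)" by simp
  note I = shifted_integral_continuous_holomorphic[OF G1 G2 continuous_on_const[of _ 1], unfolded M]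
  let ?D = "(cball 0 1 - {1}) \<times> {s. Re s > 1 - real (Suc M)} \<times> {v. Re v > (0::real)}"
  have "continuous_on ?D (\<lambda>p. (\<lambda>(z, s, v). ?I z s v) p)" using I(1) by simp
  then have "continuous_on ?D (\<lambda>p. ?H (fst p) (fst (snd p)) (snd (snd p)))"
    unfolding case_prod_unfold by (intro continuous_intros) auto
  moreover have "(\<lambda>s. ?H z s v) holomorphic_on {s. Re s > 1 - real (Suc M)}"
    if "z \<in> cball 0 1 - {1}" "Re v > 0" for z v
  proof -
    have "(\<lambda>s. ?I z s v) holomorphic_on {s. Re s > 1 - real (Suc M)}"
      using that by (intro I(2))
    then show ?thesis using that by (intro holomorphic_intros) auto
  qed
  moreover have "?H z s v = lerch_series z s v"
    if "z \<in> cball 0 1 - {1}" "Re s > 1 - real (Suc M)" "Re v > 0" "norm z < 1 \<or> Re s > 1" for z s v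
  proof -
    have "?I z s v = integral {0..1} (\<lambda>u::real. lerch_series z (s + 1) (v + of_real u))"
      by (intro integral_cong, simp, rule G3) (use that in auto)
    then have "s * ?I z s v = integral {0..1} (\<lambda>u::real. s * lerch_series z (s + 1) (v + of_real u))"
      by simp
    moreover have "norm z < 1 \<or> norm z \<le> 1 \<and> Re s > 1" using that by auto
    ultimately have "(1 - z) * lerch_series z s v = 1 / v powr s - z * (s * ?I z s v)"
      using lerch_series_integral_equation that by (simp only:)
    moreover have "1 - z \<noteq> 0" using that by auto
    ultimately show ?thesis by (metis nonzero_mult_div_cancel_left)
  qed
  ultimately show ?case
    unfolding case_prod_unfold by (intro exI[of _ ?H] conjI ballI allI impI) simp_all
qed

text \<open>
The dummy first variable, confined to \<open>{1}\<close>, gives the statement the form to which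
\<open>shifted_integral_continuous_holomorphic\<close> applies.
\<close>

lemma hurwitz_series_continuation:
  "\<exists>H. continuous_on ({1} \<times> {s. Re s > 1 - real M} \<times> {v. Re v > 0}) (\<lambda>(z::complex, s, v). H s v)
     \<and> (\<forall>v. Re v > 0 \<longrightarrow> (\<lambda>s. H s v) holomorphic_on {s. Re s > 1 - real M})
     \<and> (\<forall>s v. Re s > 1 \<longrightarrow> Re v > 0 \<longrightarrow> H s v = (s - 1) * lerch_series 1 s v)"
proof (induction M)
  case 0
  have "continuous_on ({1} \<times> {s. Re s > 1} \<times> {v. Re v > 0}) (\<lambda>p. (\<lambda>(z, s, v). lerch_series z s v) p)"
    by (rule continuous_on_subset[OF lerch_series_continuous_on]) auto
  then have "continuous_on ({1} \<times> {s. Re s > 1} \<times> {v. Re v > 0})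
      (\<lambda>p. (fst (snd p) - 1) * (\<lambda>(z, s, v). lerch_series z s v) p)"
    by (intro continuous_intros)
  then have "continuous_on ({1} \<times> {s. Re s > 1} \<times> {v. Re v > 0})
      (\<lambda>(z::complex, s, v). (s - 1) * lerch_series 1 s v)"
    by (rule continuous_on_eq) auto
  moreover have "(\<lambda>s. (s - 1) * lerch_series 1 s v) holomorphic_on {s. Re s > 1}" if "Re v > 0" for v
    using that by (intro holomorphic_intros lerch_series_holomorphic_in_exponent) auto
  ultimately show ?case
    by (intro exI[of _ "\<lambda>s v. (s - 1) * lerch_series 1 s v"]) simp
next
  case (Suc M)
  then obtain H where
      H1: "continuous_on ({1} \<times> {s. Re s > 1 - real M} \<times> {v. Re v > 0}) (\<lambda>(z::complex, s, v). H s v)"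
    and H2: "\<And>v. Re v > 0 \<Longrightarrow> (\<lambda>s. H s v) holomorphic_on {s. Re s > 1 - real M}"
    and H3: "\<And>s v. Re s > 1 \<Longrightarrow> Re v > 0 \<Longrightarrow> H s v = (s - 1) * lerch_series 1 s v"
    by (elim exE conjE) metis
  let ?I = "\<lambda>s v. integral {0..1} (\<lambda>u::real. (1 - of_real u) * H (s + 1) (v + of_real u))"
  let ?H = "\<lambda>s v. v powr (1 - s) + (s - 1) * ?I s v"
  have M: "1 - real M - 1 = 1 - real (Suc M)" by simp
  have "continuous_on {0..1::real} (\<lambda>u. 1 - of_real u :: complex)" by (intro continuous_intros)
  note I = shifted_integral_continuous_holomorphic[of "{1}" _ "\<lambda>_. H", OF H1 H2 this, unfolded M]
  let ?D = "{1::complex} \<times> {s. Re s > 1 - real (Suc M)} \<times> {v. Re v > (0::real)}"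
  have "continuous_on ?D (\<lambda>p. (\<lambda>(z, s, v). ?I s v) p)" using I(1) by simp
  then have "continuous_on ?D (\<lambda>p. ?H (fst (snd p)) (snd (snd p)))"
    unfolding case_prod_unfold by (intro continuous_intros) (auto simp: complex_eq_iff)
  moreover have "(\<lambda>s. ?H s v) holomorphic_on {s. Re s > 1 - real (Suc M)}" if "Re v > 0" for v
    using I(2)[OF _ _ that] that by (intro holomorphic_intros) auto
  moreover have "?H s v = (s - 1) * lerch_series 1 s v" if "Re s > 1" "Re v > 0" for s v
  proof -
    have "?I s v = integral {0..1} (\<lambda>u::real. (1 - of_real u) * (s * lerch_series 1 (s + 1) (v + of_real u)))"
      using that by (intro integral_cong) (auto simp: H3)
    then show ?thesis
      using hurwitz_series_integral_equation[of s v] that by simp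
  qed
  ultimately show ?case
    unfolding case_prod_unfold by (intro exI[of _ ?H] conjI allI impI) simp_all
qed

section \<open>Continuation in the first argument\<close>

lemma has_integral_change_of_variables_complex:
  fixes f :: "real \<Rightarrow> complex" and g g' :: "real \<Rightarrow> real"
  assumes "S \<in> sets lebesgue"
    and "\<And>x. x \<in> S \<Longrightarrow> (g has_field_derivative g' x) (at x within S)" and "inj_on g S"
    and f: "f absolutely_integrable_on g ` S" "(f has_integral b) (g ` S)"
  shows "((\<lambda>x. of_real \<bar>g' x\<bar> * f (g x)) has_integral b) S"
proof -
  have real: "((\<lambda>x. \<bar>g' x\<bar> * h (f (g x))) has_integral h b) S" if "bounded_linear h" for h
  proof -
    have "(\<lambda>x. h (f x)) absolutely_integrable_on g ` S"
      using absolutely_integrable_linear[OF f(1) that] by (simp add: o_def)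
    moreover have "integral (g ` S) (\<lambda>x. h (f x)) = h b"
      using has_integral_linear[OF f(2) that] by (simp add: o_def integral_unique)
    ultimately have "(\<lambda>x. \<bar>g' x\<bar> * h (f (g x))) absolutely_integrable_on S
        \<and> integral S (\<lambda>x. \<bar>g' x\<bar> * h (f (g x))) = h b"
      using has_absolute_integral_change_of_variables_1'[OF assms(1-3), of "\<lambda>x. h (f x)" "h b"] by simp
    then show ?thesis
      by (simp add: has_integral_iff set_lebesgue_integral_eq_integral(1))
  qed
  have "((\<lambda>x. of_real (\<bar>g' x\<bar> * Re (f (g x))) + \<i> * of_real (\<bar>g' x\<bar> * Im (f (g x)))) has_integral
      of_real (Re b) + \<i> * of_real (Im b)) S"
    using has_integral_linear[OF real[OF bounded_linear_Re] bounded_linear_of_real]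
      has_integral_linear[OF real[OF bounded_linear_Im] bounded_linear_of_real]
    unfolding o_def by (intro has_integral_add has_integral_mult_right)
  moreover have "of_real (\<bar>g' x\<bar> * Re (f (g x))) + \<i> * of_real (\<bar>g' x\<bar> * Im (f (g x)))
      = of_real \<bar>g' x\<bar> * f (g x)" for x
    by (simp add: complex_eq_iff)
  moreover have "of_real (Re b) + \<i> * of_real (Im b) = b" by (simp add: complex_eq_iff)
  ultimately show ?thesis by simp
qed

text \<open>
Euler's integral for \<open>\<Gamma>(s)\<close> under the substitution \<open>t = - a ln x\<close>.
\<close>

lemma has_integral_powr_log_of_real:
  fixes a :: real and s :: complex
  assumes "a > 0" "Re s > 0"
  shows "((\<lambda>x. of_real x powr (of_real a - 1) * of_real (- ln x) powr (s - 1)) has_integral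
           Gamma s / of_real a powr s) {0<..<1}"
proof -
  let ?f = "\<lambda>t. of_real t powr (s - 1) / of_real (exp t) :: complex"
  let ?g = "\<lambda>x::real. - a * ln x"
  have img: "?g ` {0<..<1} = {0<..}"
  proof (intro equalityI subsetI)
    fix t :: real assume "t \<in> {0<..}"
    then have "t = ?g (exp (- t / a))" "exp (- t / a) \<in> {0<..<1}" using assms by auto
    then show "t \<in> ?g ` {0<..<1}" by blast
  qed (use assms in \<open>auto simp: mult_pos_neg\<close>)
  have "((\<lambda>x. of_real \<bar>- a / x\<bar> * ?f (?g x)) has_integral Gamma s) {0<..<1}"
  proof (rule has_integral_change_of_variables_complex)
    show "{0<..<1::real} \<in> sets lebesgue" by simp
    show "(?g has_field_derivative - a / x) (at x within {0<..<1})" if "x \<in> {0<..<1}" for x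
      using that by (auto intro!: derivative_eq_intros)
    show "inj_on ?g {0<..<1}" using assms by (auto intro!: inj_onI)
    show "?f absolutely_integrable_on ?g ` {0<..<1}"
      unfolding img by (rule absolutely_integrable_Gamma_integral'[OF assms(2)])
    show "(?f has_integral Gamma s) (?g ` {0<..<1})"
      unfolding img by (rule Gamma_integral_complex'[OF assms(2)])
  qed
  moreover have "of_real \<bar>- a / x\<bar> * ?f (?g x)
      = of_real a powr s * (of_real x powr (of_real a - 1) * of_real (- ln x) powr (s - 1))"
    if "x \<in> {0<..<1}" for x
  proof -
    have x: "0 < x" "ln x < 0" using that by auto
    have "of_real (?g x) powr (s - 1) = of_real a powr (s - 1) * of_real (- ln x) powr (s - 1)"
      using powr_times_real_left[of "of_real a" "of_real (- ln x)" "s - 1"] assms by simp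
    moreover have "of_real (exp (?g x)) = inverse (of_real x powr of_real a :: complex)"
    proof -
      have "exp (?g x) = inverse (x powr a)" using x by (simp add: powr_def exp_minus)
      then show ?thesis using x by (simp add: powr_of_real)
    qed
    moreover have "of_real x powr of_real a = of_real x * (of_real x powr (of_real a - 1) :: complex)"
      using x powr_add[of "of_real x :: complex" 1 "of_real a - 1"] by simp
    moreover have "\<bar>- a / x\<bar> = a / x" using x assms by simp
    ultimately have "of_real \<bar>- a / x\<bar> * ?f (?g x)
        = of_real (a / x) * (of_real a powr (s - 1) * of_real (- ln x) powr (s - 1)
            / inverse (of_real x * of_real x powr (of_real a - 1)))"
      by (simp only:)
    also have "of_real (a / x) * (p * q / inverse (of_real x * y)) = of_real a * p * (y * q)"
      for p q y :: complex using x by (simp add: field_simps)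
    also have "of_real a * of_real a powr (s - 1) = (of_real a powr s :: complex)"
      using assms powr_add[of "of_real a :: complex" 1 "s - 1"] by simp
    finally show ?thesis .
  qed
  ultimately have "((\<lambda>x. of_real a powr s * (of_real x powr (of_real a - 1) * of_real (- ln x) powr (s - 1)))
      has_integral Gamma s) {0<..<1}"
    by (rule has_integral_eq[rotated])
  from has_integral_mult_right[OF this, of "1 / of_real a powr s"] show ?thesis
    using assms by simp
qed

text \<open>
The factor \<open>x\<close> outweighs the logarithm at \<open>0\<close>, and \<open>Re s > 1\<close> makes the power of \<open>- ln x\<close> vanish at
\<open>1\<close>. With \<open>ln 0 = 0\<close> the expression takes the limit value at \<open>x = 0\<close>.
\<close>

lemma continuous_on_mult_log_powr:
  assumes "Re s > 1"
  shows "continuous_on {0..1} (\<lambda>x. of_real x * of_real (- ln x) powr (s - 1) :: complex)"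
proof (unfold continuous_on_eq_continuous_within, rule ballI)
  let ?w = "\<lambda>x. of_real x * of_real (- ln x) powr (s - 1) :: complex"
  fix x :: real assume x: "x \<in> {0..1}"
  show "continuous (at x within {0..1}) ?w"
  proof (cases "x = 0")
    case False
    have "continuous_on {0<..1} ?w"
      using assms by (intro continuous_intros) auto
    then have "continuous (at x within {0<..1}) ?w"
      using x False by (simp add: continuous_on_eq_continuous_within)
    moreover have "at x within {0<..1} = at x within {0..1}"
      using x False by (intro at_within_nhd[of _ "{0<..}"]) auto
    ultimately show ?thesis by simp
  next
    case True
    have "((\<lambda>x. x * (- ln x) powr (Re s - 1)) \<longlongrightarrow> 0) (at_right (0::real))"
      using assms by real_asymp
    then have "((\<lambda>x. x * (- ln x) powr (Re s - 1)) \<longlongrightarrow> 0) (at 0 within {0..1::real})"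
      by (simp add: at_within_Icc_at_right)
    moreover have "\<forall>\<^sub>F x in at 0 within {0..1::real}. norm (?w x) \<le> x * (- ln x) powr (Re s - 1)"
      unfolding eventually_at_filter
      by (intro always_eventually) (auto simp: norm_mult norm_powr_real_powr)
    ultimately have "(?w \<longlongrightarrow> 0) (at 0 within {0..1::real})"
      by (rule Lim_null_comparison[rotated])
    then show ?thesis using True by (simp add: continuous_within)
  qed
qed

text \<open>
Replacing \<open>v\<close> by \<open>v + j\<close> multiplies the integrand by \<open>x ^ j\<close>, so the values \<open>(v + j) powr - s\<close> are
moments up to the factor \<open>\<Gamma>(s)\<close>.
For real \<open>v\<close> this is \<open>has_integral_powr_log_of_real\<close>; both sides are holomorphic in \<open>v\<close>, and the
identity theorem gives the complex case. One factor \<open>x\<close> of \<open>x powr (v - 1)\<close> is kept with the logarithm,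
which leaves \<open>x powr (v - 2)\<close> and accounts for the bound on \<open>Re v\<close>.
\<close>

lemma has_integral_powr_log:
  fixes v s :: complex
  assumes "Re v > 2" "Re s > 1"
  shows "((\<lambda>x. of_real x powr (v - 2) * (of_real x * of_real (- ln x) powr (s - 1))) has_integral
           Gamma s / v powr s) {0..1}"
proof -
  let ?U = "{v. Re v > (2::real)}"
  let ?f = "\<lambda>v x. of_real x powr (v - 2) * (of_real x * of_real (- ln x) powr (s - 1)) :: complex"
  have "continuous_on (?U \<times> {0..1}) (\<lambda>p. of_real (snd p) powr (fst p - 2))"
    by (intro continuous_intros) auto
  moreover have "continuous_on (?U \<times> {0..1})
      (\<lambda>p. of_real (snd p) * of_real (- ln (snd p)) powr (s - 1) :: complex)"
    using assms by (intro continuous_on_compose2[OF continuous_on_mult_log_powr] continuous_intros) auto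
  ultimately have cont: "continuous_on (?U \<times> {0..1}) (\<lambda>(v, x). ?f v x)"
    unfolding case_prod_unfold by (rule continuous_on_mult)
  have U: "open ?U" "connected ?U"
    by (auto intro: open_halfspace_Re_gt convex_connected convex_halfspace_Re_gt)
  have hol: "(\<lambda>v. integral {0..1} (?f v)) holomorphic_on ?U"
    using U(1) cont
    by (rule holomorphic_on_parameter_integral) (intro holomorphic_intros)
  have real: "integral {0..1} (?f (of_real a)) = Gamma s / of_real a powr s" if "a > 2" for a
  proof -
    have "((\<lambda>x. of_real x powr (of_real a - 1) * of_real (- ln x) powr (s - 1)) has_integral
           Gamma s / of_real a powr s) {0<..<1}"
      using that assms by (intro has_integral_powr_log_of_real) auto
    then have "(?f (of_real a) has_integral Gamma s / of_real a powr s) {0<..<1}"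
    proof (rule has_integral_eq[rotated])
      fix x :: real assume "x \<in> {0<..<1}"
      then have "(of_real x :: complex) powr (of_real a - 1) = of_real x powr (of_real a - 2) * of_real x"
        using powr_add[of "of_real x :: complex" "of_real a - 2" 1] by simp
      then show "of_real x powr (of_real a - 1) * of_real (- ln x) powr (s - 1) = ?f (of_real a) x"
        by simp
    qed
    then have "(?f (of_real a) has_integral Gamma s / of_real a powr s) {0..1}"
      by (simp add: has_integral_Icc_iff_Ioo)
    then show ?thesis by (rule integral_unique)
  qed
  have "integral {0..1} (?f v) - Gamma s / v powr s = 0"
  proof (rule analytic_continuation[where f = "\<lambda>v. integral {0..1} (?f v) - Gamma s / v powr s"
        and w = v and S = ?U and U = "of_real ` {2<..}" and \<xi> = 3])
    show "(\<lambda>v. integral {0..1} (?f v) - Gamma s / v powr s) holomorphic_on ?U"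
      using hol by (intro holomorphic_intros) (auto simp: complex_nonpos_Reals_iff)
    show "(3::complex) islimpt of_real ` {2<..}"
    proof -
      have "\<exists>x'\<in>of_real ` {2<..}. x' \<noteq> (3::complex) \<and> dist x' 3 < e" if "e > 0" for e :: real
      proof (intro bexI conjI)
        have "of_real (3 + e / 2) - (3::complex) = of_real (e / 2)" by simp
        then have "dist (of_real (3 + e / 2)) (3::complex) = \<bar>e / 2\<bar>"
          unfolding dist_norm by (simp only: norm_of_real)
        then show "dist (of_real (3 + e / 2)) (3::complex) < e" "of_real (3 + e / 2) \<noteq> (3::complex)"
          using that by auto
        show "of_real (3 + e / 2) \<in> (of_real ` {2<..} :: complex set)" using that by (intro imageI) simp
      qed
      then show ?thesis unfolding islimpt_approachable by blast
    qed
    show "integral {0..1} (?f v) - Gamma s / v powr s = 0" if "v \<in> of_real ` {2<..}" for v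
      using that real by auto
  qed (use U assms in auto)
  moreover have "?f v integrable_on {0..1}"
  proof -
    have "continuous_on {0..1} (\<lambda>x. ?f v x)"
      using assms by (intro continuous_on_uncurried_compose[OF cont]) auto
    then show ?thesis by (rule integrable_continuous_real)
  qed
  ultimately show ?thesis by (simp add: has_integral_iff)
qed

lemma open_Compl_lerch_cut: "open (- lerch_cut)"
proof -
  have "lerch_cut = {z. Re z \<ge> 1} \<inter> {z. Im z = 0}"
    by (auto simp: lerch_cut_def image_iff complex_eq_iff)
  moreover have "closed ({z. Re z \<ge> 1} \<inter> {z. Im z = 0})"
    by (intro closed_Int closed_halfspace_Re_ge closed_Collect_eq continuous_intros)
  ultimately show ?thesis by (simp add: open_Compl)
qed

text \<open>
Summing the geometric series under the moment integral replaces \<open>\<Sum>j. (z x) ^ j\<close> by \<open>1 / (1 - z x)\<close>, which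
for \<open>x\<close> in the unit interval is holomorphic in \<open>z\<close> off the cut.
\<close>

lemma lerch_series_continuation_moment:
  assumes "Re v > 2" "Re s > 1"
  shows "\<exists>F. F holomorphic_on - lerch_cut \<and> (\<forall>z\<in>ball 0 1. F z = lerch_series z s v)"
proof -
  define c :: "real \<Rightarrow> complex"
    where "c = (\<lambda>x. of_real x powr (v - 2) * (of_real x * of_real (- ln x) powr (s - 1)))"
  let ?F = "\<lambda>z. integral {0..1} (\<lambda>x. c x / (1 - z * of_real x))"
  have c: "continuous_on {0..1} c" unfolding c_def
    using assms by (intro continuous_on_mult[OF _ continuous_on_mult_log_powr] continuous_intros) auto
  have nz: "z * of_real x \<noteq> 1" if "z \<in> - lerch_cut" "x \<in> {0..1}" for z and x :: real
  proof
    assume *: "z * of_real x = 1"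
    then have "x \<noteq> 0" by auto
    then have "z = of_real (1 / x)" using * by (simp add: field_simps)
    moreover have "1 / x \<ge> 1" using that \<open>x \<noteq> 0\<close> by simp
    ultimately have "z \<in> lerch_cut" unfolding lerch_cut_def by (intro image_eqI[of _ _ "1 / x"]) auto
    then show False using that by simp
  qed
  have hol: "?F holomorphic_on - lerch_cut"
  proof (rule holomorphic_on_parameter_integral[OF open_Compl_lerch_cut])
    have "continuous_on ((- lerch_cut) \<times> {0..1}) (\<lambda>p. c (snd p))"
      by (intro continuous_on_compose2[OF c] continuous_intros) auto
    then have "continuous_on ((- lerch_cut) \<times> {0..1}) (\<lambda>p. c (snd p) / (1 - fst p * of_real (snd p)))"
      by (intro continuous_intros) (auto simp: nz)
    then show "continuous_on ((- lerch_cut) \<times> {0..1}) (\<lambda>(z, x). c x / (1 - z * of_real x))"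
      by (simp add: case_prod_unfold)
    show "(\<lambda>z. c x / (1 - z * of_real x)) holomorphic_on - lerch_cut" if "x \<in> {0..1}" for x
      using that by (intro holomorphic_intros) (auto simp: nz)
  qed
  have series: "?F z = Gamma s * lerch_series z s v" if z: "norm z < 1" for z
  proof -
    obtain C where C: "\<And>x. x \<in> {0..1} \<Longrightarrow> norm (c x) \<le> C"
      using compact_imp_bounded[OF compact_continuous_image[OF c compact_Icc]]
      unfolding bounded_iff by blast
    have C0: "0 \<le> C" using order_trans[OF norm_ge_zero C[of 0]] by simp
    have "norm (c x * (z * of_real x) ^ j) \<le> C * norm z ^ j" if "x \<in> {0..1}" for j x
    proof -
      have "norm (c x) * (norm z * \<bar>x\<bar>) ^ j \<le> C * norm z ^ j"
        using that C[OF that] C0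
        by (intro mult_mono power_mono) (auto simp: mult_left_le intro: order_trans)
      then show ?thesis by (simp add: norm_mult norm_power)
    qed
    then have ul0: "uniform_limit {0..1} (\<lambda>n x. \<Sum>j<n. c x * (z * of_real x) ^ j)
        (\<lambda>x. \<Sum>j. c x * (z * of_real x) ^ j) sequentially"
      using z by (intro Weierstrass_m_test summable_mult summable_geometric) auto
    have geom: "(\<Sum>j. c x * (z * of_real x) ^ j) = c x / (1 - z * of_real x)" if "x \<in> {0..1}" for x
    proof -
      have "norm (z * of_real x) < 1"
      proof -
        have "norm (z * of_real x) \<le> norm z" using that by (simp add: norm_mult mult_left_le)
        then show ?thesis using z by simp
      qed
      then have "(\<lambda>j. c x * (z * of_real x) ^ j) sums (c x * (1 / (1 - z * of_real x)))"
        by (intro sums_mult geometric_sums)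
      then show ?thesis by (simp add: sums_iff)
    qed
    have ul: "uniform_limit {0..1} (\<lambda>n x. \<Sum>j<n. c x * (z * of_real x) ^ j)
        (\<lambda>x. c x / (1 - z * of_real x)) sequentially"
      by (rule iffD1[OF uniform_limit_cong'[OF refl geom] ul0])
    have "continuous_on {0..1} (\<lambda>x. \<Sum>j<n. c x * (z * of_real x) ^ j)" for n
      by (intro continuous_intros c)
    then obtain I J where IJ: "\<And>n. ((\<lambda>x. \<Sum>j<n. c x * (z * of_real x) ^ j) has_integral I n) {0..1}"
      "((\<lambda>x. c x / (1 - z * of_real x)) has_integral J) {0..1}" "I \<longlonglongrightarrow> J"
      by (rule uniform_limit_integral[OF ul]) auto
    have mom: "((\<lambda>x. c x * (z * of_real x) ^ j) has_integral Gamma s * (z ^ j / (of_nat j + v) powr s)) {0..1}" for j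
    proof -
      have "((\<lambda>x. z ^ j * (of_real x powr (of_nat j + v - 2) * (of_real x * of_real (- ln x) powr (s - 1))))
          has_integral z ^ j * (Gamma s / (of_nat j + v) powr s)) {0..1}"
        using assms by (intro has_integral_mult_right has_integral_powr_log) auto
      moreover have "z ^ j * (of_real x powr (of_nat j + v - 2) * (of_real x * of_real (- ln x) powr (s - 1)))
          = c x * (z * of_real x) ^ j" for x
      proof (cases "x = 0")
        case False
        then have "(of_real x :: complex) powr (of_nat j + v - 2) = of_real x ^ j * of_real x powr (v - 2)"
          using powr_add[of "of_real x :: complex" "of_nat j" "v - 2"] by (simp add: add_diff_eq)
        then show ?thesis by (simp add: c_def power_mult_distrib mult_ac)
      qed (simp add: c_def)
      ultimately show ?thesis by (simp add: mult_ac)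
    qed
    have "I n = (\<Sum>j<n. Gamma s * (z ^ j / (of_nat j + v) powr s))" for n
      by (rule has_integral_unique[OF IJ(1)]) (intro has_integral_sum mom finite_lessThan)
    then have "I = (\<lambda>n. \<Sum>j<n. Gamma s * (z ^ j / (of_nat j + v) powr s))" ..
    then have "(\<lambda>j. Gamma s * (z ^ j / (of_nat j + v) powr s)) sums J"
      using IJ(3) by (simp add: sums_def)
    moreover have "(\<lambda>j. Gamma s * (z ^ j / (of_nat j + v) powr s)) sums (Gamma s * lerch_series z s v)"
      unfolding lerch_series_def using z by (intro sums_mult summable_sums lerch_series_split(2)) auto
    ultimately have "J = Gamma s * lerch_series z s v" by (rule sums_unique2)
    then show ?thesis using IJ(2) by (simp add: integral_unique)
  qed
  have "Gamma s \<noteq> 0"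
    using assms by (auto simp: Gamma_eq_zero_iff elim!: nonpos_Ints_cases)
  then show ?thesis
    using hol series by (intro exI[of _ "\<lambda>z. ?F z / Gamma s"]) (auto intro!: holomorphic_intros)
qed

text \<open>
On coefficients, \<open>z d/dz + v\<close> is multiplication by \<open>j + v\<close>.
\<close>

lemma lerch_series_derivative:
  assumes "F holomorphic_on ball 0 1" "\<And>z. z \<in> ball 0 1 \<Longrightarrow> F z = lerch_series z s v"
    and "\<And>j. of_nat j + v \<noteq> 0" and z: "z \<in> ball 0 1"
  shows "z * deriv F z + v * F z = lerch_series z (s - 1) v"
proof -
  define a where "a = (\<lambda>j. 1 / (of_nat j + v) powr s)"
  have sums: "(\<lambda>j. a j * z ^ j) sums F z" if "norm z < 1" for z
    using that assms(2)[of z] lerch_series_split(2)[of z s v]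
    by (simp add: a_def lerch_series_def summable_sums)
  have "(F has_field_derivative deriv F z) (at z)"
    using assms(1) z by (auto intro: holomorphic_derivI)
  then have "(\<lambda>j. diffs a j * z ^ j) sums deriv F z"
    using z by (intro termdiffs_sums_strong[OF sums]) auto
  from sums_mult[OF this, of z]
  have "(\<lambda>j. of_nat (Suc j) * a (Suc j) * z ^ Suc j) sums (z * deriv F z)"
    by (simp add: diffs_def mult_ac)
  then have "(\<lambda>j. of_nat j * a j * z ^ j) sums (z * deriv F z)"
    by (subst (asm) sums_Suc_iff) simp
  moreover have "(\<lambda>j. v * (a j * z ^ j)) sums (v * F z)"
    using z by (intro sums_mult sums) auto
  ultimately have "(\<lambda>j. of_nat j * a j * z ^ j + v * (a j * z ^ j)) sums (z * deriv F z + v * F z)"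
    by (rule sums_add)
  moreover have "of_nat j * a j * z ^ j + v * (a j * z ^ j) = z ^ j / (of_nat j + v) powr (s - 1)" for j
  proof -
    have "(of_nat j + v) powr s = (of_nat j + v) * (of_nat j + v) powr (s - 1)"
      using powr_add[of "of_nat j + v" 1 "s - 1"] assms(3)[of j] by simp
    then have "a j = 1 / ((of_nat j + v) * (of_nat j + v) powr (s - 1))"
      by (simp add: a_def)
    moreover have "of_nat j * a j * z ^ j + v * (a j * z ^ j) = (of_nat j + v) * a j * z ^ j"
      by (simp add: algebra_simps)
    ultimately show ?thesis using assms(3)[of j] by simp
  qed
  ultimately show ?thesis by (simp add: lerch_series_def sums_iff)
qed

lemma ball_subset_Compl_lerch_cut: "ball 0 1 \<subseteq> - lerch_cut"
  by (auto simp: lerch_cut_def)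

text \<open>
From the half-planes of \<open>lerch_series_continuation_moment\<close>, the exponent is lowered by
\<open>lerch_series_derivative\<close>, and \<open>v\<close> is moved to the left by restoring initial terms.
\<close>

lemma lerch_series_continuation_slit_plane:
  "\<exists>F. F holomorphic_on - lerch_cut \<and> (\<forall>z\<in>ball 0 1. F z = lerch_series z s v)"
proof -
  obtain K :: nat where "2 - Re v < real K" using reals_Archimedean2 by blast
  then have v: "Re (v + of_nat K) > 2" by simp
  obtain M :: nat where M: "1 - Re s < real M" using reals_Archimedean2 by blast
  have "\<exists>F. F holomorphic_on - lerch_cut \<and> (\<forall>z\<in>ball 0 1. F z = lerch_series z s (v + of_nat K))"
    using M
  proof (induction M arbitrary: s)
    case 0
    then show ?case using v by (intro lerch_series_continuation_moment) auto
  next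
    case (Suc M)
    then have "1 - Re (s + 1) < real M" by simp
    from Suc.IH[OF this] obtain F where F: "F holomorphic_on - lerch_cut"
        "\<And>z. z \<in> ball 0 1 \<Longrightarrow> F z = lerch_series z (s + 1) (v + of_nat K)"
      by blast
    have nz: "of_nat j + (v + of_nat K) \<noteq> 0" for j
      using v by (intro of_nat_add_neq_0) simp
    have "F holomorphic_on ball 0 1"
      using F(1) ball_subset_Compl_lerch_cut by (rule holomorphic_on_subset)
    then have "z * deriv F z + (v + of_nat K) * F z = lerch_series z s (v + of_nat K)" if "z \<in> ball 0 1" for z
      using lerch_series_derivative[OF _ F(2) nz that] by simp
    moreover have "(\<lambda>z. z * deriv F z + (v + of_nat K) * F z) holomorphic_on - lerch_cut"
      by (intro holomorphic_intros holomorphic_deriv F(1) open_Compl_lerch_cut)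
    ultimately show ?case by blast
  qed
  then obtain F where F: "F holomorphic_on - lerch_cut"
      "\<And>z. z \<in> ball 0 1 \<Longrightarrow> F z = lerch_series z s (v + of_nat K)"
    by blast
  let ?G = "\<lambda>z. (\<Sum>j<K. z ^ j * (1 / (of_nat j + v) powr s)) + z ^ K * F z"
  have "?G holomorphic_on - lerch_cut" by (intro holomorphic_intros F(1))
  moreover have "?G z = lerch_series z s v" if "z \<in> ball 0 1" for z
    using that F(2)[of z] lerch_series_split(1)[of z s v K] by simp
  ultimately show ?thesis by blast
qed

section \<open>Analyticity of the Lerch function\<close>

lemma nonpos_Ints_shift_neq_0:
  fixes v :: complex
  assumes "v \<notin> \<int>\<^sub>\<le>\<^sub>0"
  shows "of_nat j + v \<noteq> 0"
proof
  assume "of_nat j + v = 0"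
  then have "v = - of_nat j" by (simp add: eq_neg_iff_add_eq_0 add.commute)
  then show False using assms by simp
qed

lemma cball_subset_Compl_lerch_cut: "cball 0 1 - {1} \<subseteq> - lerch_cut"
  by (auto simp: lerch_cut_def)

lemma lerch_series_continuation_in_exponent:
  assumes "v \<notin> \<int>\<^sub>\<le>\<^sub>0"
  shows "\<exists>G. (\<forall>s. Re s > c \<longrightarrow> continuous_on (cball 0 1 - {1}) (\<lambda>z. G z s))
     \<and> (\<forall>z\<in>cball 0 1 - {1}. (\<lambda>s. G z s) holomorphic_on {s. Re s > c})
     \<and> (\<forall>z\<in>cball 0 1 - {1}. \<forall>s. Re s > c \<longrightarrow> norm z < 1 \<or> Re s > 1 \<longrightarrow> G z s = lerch_series z s v)"
proof -
  obtain K :: nat where "- Re v < real K" using reals_Archimedean2 by blast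
  then have v: "Re (v + of_nat K) > 0" by simp
  obtain M :: nat where "1 - c < real M" using reals_Archimedean2 by blast
  then have M: "1 - real M < c" by simp
  obtain G where
      G1: "continuous_on ((cball 0 1 - {1}) \<times> {s. Re s > 1 - real M} \<times> {v. Re v > 0}) (\<lambda>(z, s, v). G z s v)"
    and G2: "\<forall>z\<in>cball 0 1 - {1}. \<forall>v. Re v > 0 \<longrightarrow> (\<lambda>s. G z s v) holomorphic_on {s. Re s > 1 - real M}"
    and G3: "\<forall>z\<in>cball 0 1 - {1}. \<forall>s v. Re s > 1 - real M \<longrightarrow> Re v > 0 \<longrightarrow> norm z < 1 \<or> Re s > 1
        \<longrightarrow> G z s v = lerch_series z s v"
    using lerch_series_continuation_right_half_plane[of M] by (elim exE conjE) (rule that)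
  let ?H = "\<lambda>z s. (\<Sum>j<K. z ^ j / (of_nat j + v) powr s) + z ^ K * G z s (v + of_nat K)"
  note nz = nonpos_Ints_shift_neq_0[OF assms]
  have "continuous_on (cball 0 1 - {1}) (\<lambda>z. ?H z s)" if "Re s > c" for s
  proof -
    have "continuous_on (cball 0 1 - {1}) (\<lambda>z. (z, s, v + of_nat K))" by (intro continuous_intros)
    then have "continuous_on (cball 0 1 - {1}) (\<lambda>z. (\<lambda>(z, s, v). G z s v) (z, s, v + of_nat K))"
      by (rule continuous_on_compose2[OF G1]) (use that M v in auto)
    then show ?thesis using nz by (intro continuous_intros) auto
  qed
  moreover have "(\<lambda>s. ?H z s) holomorphic_on {s. Re s > c}" if "z \<in> cball 0 1 - {1}" for z
  proof -
    have "(\<lambda>s. G z s (v + of_nat K)) holomorphic_on {s. Re s > 1 - real M}"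
      using bspec[OF G2 that] v by blast
    then have "(\<lambda>s. G z s (v + of_nat K)) holomorphic_on {s. Re s > c}"
      by (rule holomorphic_on_subset) (use M in auto)
    then show ?thesis using nz by (intro holomorphic_intros) auto
  qed
  moreover have "?H z s = lerch_series z s v"
    if z: "z \<in> cball 0 1 - {1}" and s: "Re s > c" "norm z < 1 \<or> Re s > 1" for z s
  proof -
    have "Re s > 1 - real M" using s M by simp
    then have "G z s (v + of_nat K) = lerch_series z s (v + of_nat K)"
      using bspec[OF G3 z] v s by blast
    moreover have "norm z < 1 \<or> norm z \<le> 1 \<and> Re s > 1" using z s by auto
    ultimately show ?thesis using lerch_series_split(1)[of z s v K] by simp
  qed
  ultimately show ?thesis by (intro exI[of _ ?H] conjI allI impI ballI)
qed

text \<open>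
Both values at \<open>z\<close> are limits along the radius towards \<open>z\<close>.
\<close>

lemma eq_on_cball_if_eq_on_ball:
  fixes f g :: "complex \<Rightarrow> complex"
  assumes "continuous_on (cball 0 1 - {1}) f" "continuous_on (cball 0 1 - {1}) g"
    and eq: "\<And>z. z \<in> ball 0 1 \<Longrightarrow> f z = g z" and z: "z \<in> cball 0 1 - {1}"
  shows "f z = g z"
proof -
  let ?r = "\<lambda>n. of_real (1 - 1 / real (Suc (Suc n))) * z"
  have r: "?r n \<in> ball 0 1" for n
  proof -
    have "norm (?r n) = (1 - 1 / real (Suc (Suc n))) * norm z"
      unfolding norm_mult norm_of_real by simp
    also have "\<dots> \<le> (1 - 1 / real (Suc (Suc n))) * 1"
      using z by (intro mult_left_mono) auto
    also have "\<dots> < 1" by simp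
    finally show ?thesis by simp
  qed
  moreover have "ball 0 1 \<subseteq> cball 0 1 - {1 :: complex}" by auto
  ultimately have r': "?r n \<in> cball 0 1 - {1}" for n by blast
  have "(\<lambda>n. 1 - 1 / real (Suc (Suc n))) \<longlonglongrightarrow> 1" by real_asymp
  from tendsto_mult_right[OF tendsto_of_real[OF this], of z]
  have lim: "?r \<longlonglongrightarrow> z" by simp
  have "(\<lambda>n. f (?r n)) \<longlonglongrightarrow> f z" "(\<lambda>n. g (?r n)) \<longlonglongrightarrow> g z"
    by (rule continuous_on_tendsto_compose[OF assms(1) lim z] continuous_on_tendsto_compose[OF assms(2) lim z];
        intro always_eventually allI r')+
  moreover have "(\<lambda>n. f (?r n)) = (\<lambda>n. g (?r n))" using eq[OF r] by blast
  ultimately show ?thesis by (metis LIMSEQ_unique)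
qed

lemma connected_Compl_lerch_cut: "connected (- lerch_cut)"
proof -
  have "starlike (- lerch_cut)"
    unfolding starlike_def
  proof (intro bexI ballI subsetI)
    show "0 \<in> - lerch_cut" by (auto simp: lerch_cut_def)
    fix z w assume z: "z \<in> - lerch_cut" and "w \<in> closed_segment 0 z"
    then obtain u where u: "0 \<le> u" "u \<le> 1" "w = of_real u * z"
      by (auto simp: in_segment scaleR_conv_of_real)
    show "w \<in> - lerch_cut"
    proof
      assume "w \<in> lerch_cut"
      then obtain x where x: "w = of_real x" "x \<ge> 1" by (auto simp: lerch_cut_def)
      then have "u \<noteq> 0" using u by auto
      then have "z = of_real (x / u)" using x u by (simp add: field_simps)
      moreover have "x / u \<ge> 1" using x u \<open>u \<noteq> 0\<close> by (simp add: field_simps)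
      ultimately have "z \<in> lerch_cut" unfolding lerch_cut_def by (intro image_eqI[of _ _ "x / u"]) auto
      then show False using z by simp
    qed
  qed
  then show ?thesis by (rule starlike_imp_connected)
qed

text \<open>
The case that needs an argument is the unit circle with \<open>Re s > 1\<close>, where the value is defined by the
series: the series is continuous up to the boundary and therefore agrees there with \<open>F\<close>.
\<close>

lemma lerch_phi_eq_continuation:
  assumes F: "F holomorphic_on - lerch_cut" "\<And>z. z \<in> ball 0 1 \<Longrightarrow> F z = lerch_series z s v"
    and v: "v \<notin> \<int>\<^sub>\<le>\<^sub>0" and z: "z \<notin> lerch_cut"
  shows "lerch_phi z s v = F z"
proof -
  have z1: "z \<noteq> 1" using z by (auto simp: lerch_cut_def)
  consider "norm z < 1" | "norm z = 1" "Re s > 1" | "\<not> (norm z < 1 \<or> norm z = 1 \<and> Re s > 1)" by blast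
  then show ?thesis
  proof cases
    case 1
    then show ?thesis using z1 F(2) by (simp add: lerch_phi_def)
  next
    case 2
    obtain G where G1: "\<forall>s. Re s > 1 \<longrightarrow> continuous_on (cball 0 1 - {1}) (\<lambda>z. G z s)"
      and G3: "\<forall>z\<in>cball 0 1 - {1}. \<forall>s. Re s > 1 \<longrightarrow> norm z < 1 \<or> Re s > 1 \<longrightarrow> G z s = lerch_series z s v"
      using lerch_series_continuation_in_exponent[OF v, of 1] by (elim exE conjE) (rule that)
    have z': "z \<in> cball 0 1 - {1}" using z1 2 by simp
    have "F z = G z s"
    proof (rule eq_on_cball_if_eq_on_ball[OF _ _ _ z'])
      show "continuous_on (cball 0 1 - {1}) F"
        using holomorphic_on_imp_continuous_on[OF F(1)] cball_subset_Compl_lerch_cut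
        by (rule continuous_on_subset)
      show "continuous_on (cball 0 1 - {1}) (\<lambda>z. G z s)" using G1 2 by blast
      fix y :: complex assume y: "y \<in> ball 0 1"
      then have "y \<in> cball 0 1 - {1}" by auto
      then show "F y = G y s" using bspec[OF G3, of y] F(2)[OF y] 2 by simp
    qed
    also have "G z s = lerch_series z s v" using bspec[OF G3 z'] 2 by simp
    finally show ?thesis using z1 2 by (simp add: lerch_phi_def)
  next
    case 3
    then have "lerch_phi z s v = continuation_value (\<lambda>z. lerch_series z s v) (ball 0 1) (- lerch_cut) z"
      using z1 unfolding lerch_phi_def by (simp only: if_False)
    also have "\<dots> = F z"
      by (rule continuation_value_eq[OF open_Compl_lerch_cut connected_Compl_lerch_cut open_ball _
            ball_subset_Compl_lerch_cut _ F]) (use z in auto)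
    finally show ?thesis .
  qed
qed

lemma lerch_phi_holomorphic:
  assumes "v \<notin> \<int>\<^sub>\<le>\<^sub>0"
  shows "(\<lambda>z. lerch_phi z s v) holomorphic_on - lerch_cut"
proof -
  obtain F where F: "F holomorphic_on - lerch_cut" "\<And>z. z \<in> ball 0 1 \<Longrightarrow> F z = lerch_series z s v"
    using lerch_series_continuation_slit_plane[of s v] by blast
  show ?thesis
    using F(1) by (rule holomorphic_transform) (rule lerch_phi_eq_continuation[OF F assms ComplD, symmetric])
qed

lemma lerch_phi_eq_series:
  assumes "norm z < 1 \<or> norm z \<le> 1 \<and> Re s > 1"
  shows "lerch_phi z s v = lerch_series z s v"
proof (cases "z = 1")
  case True
  then show ?thesis using assms by (simp add: lerch_phi_def hurwitz_zeta_def)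
next
  case False
  moreover have "norm z < 1 \<or> norm z = 1 \<and> Re s > 1" using assms by linarith
  ultimately show ?thesis unfolding lerch_phi_def by (simp only: if_True if_False)
qed

text \<open>
For every exponent, the value at a boundary point is the radial limit of the values in the disc: by
\<open>lerch_phi_holomorphic\<close>, whichever clause defines it. Those values are also given by the function
\<open>G\<close> of \<open>lerch_series_continuation_in_exponent\<close>, which is holomorphic in the exponent.
\<close>

lemma lerch_phi_entire_in_exponent:
  assumes "norm z = 1" "z \<noteq> 1" "v \<notin> \<int>\<^sub>\<le>\<^sub>0"
  shows "(\<lambda>s. lerch_phi z s v) holomorphic_on UNIV"
proof -
  have z: "z \<in> cball 0 1 - {1}" using assms by simp
  have half: "(\<lambda>s. lerch_phi z s v) holomorphic_on {s. Re s > c}" for c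
  proof -
    obtain G where G1: "\<forall>s. Re s > c \<longrightarrow> continuous_on (cball 0 1 - {1}) (\<lambda>z. G z s)"
      and G2: "\<forall>z\<in>cball 0 1 - {1}. (\<lambda>s. G z s) holomorphic_on {s. Re s > c}"
      and G3: "\<forall>z\<in>cball 0 1 - {1}. \<forall>s. Re s > c \<longrightarrow> norm z < 1 \<or> Re s > 1 \<longrightarrow> G z s = lerch_series z s v"
      using lerch_series_continuation_in_exponent[OF assms(3), of c] by (elim exE conjE) (rule that)
    have eq: "lerch_phi z s v = G z s" if s: "Re s > c" for s
    proof (rule eq_on_cball_if_eq_on_ball[OF _ _ _ z])
      show "continuous_on (cball 0 1 - {1}) (\<lambda>z. lerch_phi z s v)"
        using holomorphic_on_imp_continuous_on[OF lerch_phi_holomorphic[OF assms(3)]]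
          cball_subset_Compl_lerch_cut
        by (rule continuous_on_subset)
      show "continuous_on (cball 0 1 - {1}) (\<lambda>z. G z s)" using G1 s by blast
      fix y :: complex assume y: "y \<in> ball 0 1"
      then have "y \<in> cball 0 1 - {1}" by auto
      then have "G y s = lerch_series y s v" using bspec[OF G3, of y] s y by simp
      then show "lerch_phi y s v = G y s" using y by (simp add: lerch_phi_eq_series)
    qed
    show ?thesis
      by (rule holomorphic_transform[OF bspec[OF G2 z]]) (simp add: eq)
  qed
  show ?thesis unfolding holomorphic_on_def
  proof (rule ballI)
    fix s :: complex
    have "(\<lambda>s. lerch_phi z s v) field_differentiable at s within {w. Re w > Re s - 1}"
      using half[of "Re s - 1"] by (auto simp: holomorphic_on_def)
    then show "(\<lambda>s. lerch_phi z s v) field_differentiable at s within UNIV"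
      using at_within_open[of s "{w. Re w > Re s - 1}"] by (simp add: open_halfspace_Re_gt)
  qed
qed

text \<open>
By the identity theorem the extensions agree on overlaps, so near \<open>s\<close> the one belonging to
\<open>Re s - 1\<close> may be used.
\<close>

lemma holomorphic_extension_from_half_planes:
  fixes g :: "complex \<Rightarrow> complex"
  assumes "\<And>c. \<exists>h. h holomorphic_on {s. Re s > c} \<and> (\<forall>s. Re s > c \<longrightarrow> Re s > b \<longrightarrow> h s = g s)"
  shows "\<exists>h. h holomorphic_on UNIV \<and> (\<forall>s. Re s > b \<longrightarrow> h s = g s)"
proof -
  obtain H where H: "\<And>c. H c holomorphic_on {s. Re s > c}"
      "\<And>c s. Re s > c \<Longrightarrow> Re s > b \<Longrightarrow> H c s = g s"
    using assms by metis
  have consistent: "H c s = H d s" if "Re s > c" "Re s > d" for c d s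
  proof -
    define m M where "m = max c d" and "M = max b m"
    have m: "c \<le> m" "d \<le> m" "b \<le> M" "m \<le> M" "m < Re s"
      using that by (auto simp: m_def M_def)
    have "of_real (M + 1) \<in> {s. Re s > M}" by simp
    then have ne: "{s. Re s > M} \<noteq> {}" by blast
    show ?thesis
    proof (rule analytic_continuation_open[of "{s. Re s > M}" "{s. Re s > m}" "H c" "H d" s])
      show "H c holomorphic_on {s. Re s > m}" "H d holomorphic_on {s. Re s > m}"
        by (rule holomorphic_on_subset[OF H(1)], use m in auto)+
      show "H c w = H d w" if "w \<in> {s. Re s > M}" for w
        using that m H(2)[of c w] H(2)[of d w] by simp
      show "connected {s. Re s > m}" by (intro convex_connected convex_halfspace_Re_gt)
    qed (use m ne in \<open>auto intro: open_halfspace_Re_gt\<close>)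
  qed
  let ?E = "\<lambda>s. H (Re s - 1) s"
  have "?E holomorphic_on UNIV" unfolding holomorphic_on_def
  proof (rule ballI)
    fix s :: complex
    have "?E holomorphic_on {w. Re w > Re s - 1}"
      using H(1) by (rule holomorphic_transform) (auto intro!: consistent)
    then have "?E field_differentiable at s within {w. Re w > Re s - 1}"
      by (auto simp: holomorphic_on_def)
    then show "?E field_differentiable at s within UNIV"
      using at_within_open[of s "{w. Re w > Re s - 1}"] by (simp add: open_halfspace_Re_gt)
  qed
  moreover have "?E s = g s" if "Re s > b" for s using that by (intro H(2)) auto
  ultimately show ?thesis by blast
qed

lemma hurwitz_zeta_holomorphic:
  assumes "v \<notin> \<int>\<^sub>\<le>\<^sub>0"
  shows "(\<lambda>s. hurwitz_zeta s v) holomorphic_on - {1}"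
proof -
  obtain K :: nat where "- Re v < real K" using reals_Archimedean2 by blast
  then have v: "Re (v + of_nat K) > 0" by simp
  note nz = nonpos_Ints_shift_neq_0[OF assms]
  have "\<exists>h. h holomorphic_on {s. Re s > c} \<and>
      (\<forall>s. Re s > c \<longrightarrow> Re s > 1 \<longrightarrow> h s = (s - 1) * lerch_series 1 s v)" for c
  proof -
    obtain M :: nat where "1 - c < real M" using reals_Archimedean2 by blast
    then have M: "1 - real M < c" by simp
    obtain H where H2: "\<forall>v. Re v > 0 \<longrightarrow> (\<lambda>s. H s v) holomorphic_on {s. Re s > 1 - real M}"
      and H3: "\<forall>s v. Re s > 1 \<longrightarrow> Re v > 0 \<longrightarrow> H s v = (s - 1) * lerch_series 1 s v"
      using hurwitz_series_continuation[of M] by (elim exE conjE) (rule that)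
    let ?h = "\<lambda>s. (s - 1) * (\<Sum>j<K. 1 / (of_nat j + v) powr s) + H s (v + of_nat K)"
    have "(\<lambda>s. H s (v + of_nat K)) holomorphic_on {s. Re s > 1 - real M}" using H2 v by blast
    then have "(\<lambda>s. H s (v + of_nat K)) holomorphic_on {s. Re s > c}"
      by (rule holomorphic_on_subset) (use M in auto)
    then have "?h holomorphic_on {s. Re s > c}" using nz by (intro holomorphic_intros) auto
    moreover have "?h s = (s - 1) * lerch_series 1 s v" if "Re s > 1" for s
    proof -
      have "H s (v + of_nat K) = (s - 1) * lerch_series 1 s (v + of_nat K)" using H3 v that by blast
      moreover have "lerch_series 1 s v = (\<Sum>j<K. 1 / (of_nat j + v) powr s) + lerch_series 1 s (v + of_nat K)"
        using lerch_series_split(1)[of 1 s v K] that by simp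
      ultimately show ?thesis by (simp add: algebra_simps)
    qed
    ultimately show ?thesis by blast
  qed
  then obtain E where E: "E holomorphic_on UNIV" "\<And>s. Re s > 1 \<Longrightarrow> E s = (s - 1) * lerch_series 1 s v"
    using holomorphic_extension_from_half_planes[of 1 "\<lambda>s. (s - 1) * lerch_series 1 s v"] by blast
  let ?Z = "\<lambda>s. E s / (s - 1)"
  have hol: "?Z holomorphic_on - {1}"
    by (intro holomorphic_intros holomorphic_on_subset[OF E(1)]) auto
  have series: "?Z s = lerch_series 1 s v" if "Re s > 1" for s
  proof -
    have "s \<noteq> 1" using that by auto
    then show ?thesis using E(2)[OF that] by simp
  qed
  have "hurwitz_zeta s v = ?Z s" if "s \<noteq> 1" for s
  proof (cases "Re s > 1")
    case True
    then show ?thesis using series by (simp add: hurwitz_zeta_def)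
  next
    case False
    have "continuation_value (\<lambda>s. lerch_series 1 s v) {s. Re s > 1} (- {1}) s = ?Z s"
    proof (rule continuation_value_eq)
      show "connected (- {1 :: complex})"
        by (rule connected_punctured_universe) simp
      have "(2::complex) \<in> {s. Re s > 1}" by simp
      then show "{s. Re s > 1} \<noteq> {}" by blast
    qed (use that hol series in \<open>auto intro: open_halfspace_Re_gt\<close>)
    then show ?thesis using False by (simp add: hurwitz_zeta_def)
  qed
  then show ?thesis by (intro holomorphic_transform[OF hol]) simp
qed

lemma lerch_phi_holomorphic_in_exponent:
  assumes "norm z = 1" "v \<notin> \<int>\<^sub>\<le>\<^sub>0"
  shows "(\<lambda>s. lerch_phi z s v) holomorphic_on - {1}"
proof (cases "z = 1")
  case True
  then show ?thesis using hurwitz_zeta_holomorphic[OF assms(2)] by (simp add: lerch_phi_def)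
next
  case False
  show ?thesis
    by (rule holomorphic_on_subset[OF lerch_phi_entire_in_exponent[OF assms(1) False assms(2)]]) auto
qed

section \<open>The distribution relation\<close>

text \<open>
The relation between the series is continued in \<open>w\<close> if \<open>w ^ N\<close> is off the cut, and in \<open>s\<close> if \<open>w ^ N = 1\<close>.
In the second case \<open>w\<close> may be \<open>1\<close> itself or another root of unity, so the left-hand side is a
Hurwitz zeta value or a value continued in the first argument; either is holomorphic in \<open>s \<noteq> 1\<close>.
\<close>

theorem lerch_phi_distribution:
  assumes N: "N > 0" and v: "of_nat N * v \<notin> \<int>\<^sub>\<le>\<^sub>0"
    and w: "w ^ N \<notin> lerch_cut \<or> w ^ N = 1 \<and> s \<noteq> 1"
  shows "of_nat N powr s * lerch_phi w s (of_nat N * v)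
           = (\<Sum>t<N. w ^ t * lerch_phi (w ^ N) s (v + of_nat t / of_nat N))"
proof -
  have vt: "v + of_nat t / of_nat N \<notin> \<int>\<^sub>\<le>\<^sub>0" for t
  proof
    assume "v + of_nat t / of_nat N \<in> \<int>\<^sub>\<le>\<^sub>0"
    then obtain i where i: "v + of_nat t / of_nat N = - of_nat i" by (auto elim: nonpos_Ints_cases')
    have "of_nat N * v = of_nat N * (v + of_nat t / of_nat N) - of_nat t"
      using N by (simp add: field_simps)
    also have "\<dots> = - of_nat (N * i + t)" unfolding i by simp
    finally show False using v minus_of_nat_in_nonpos_Ints by metis
  qed
  have series: "of_nat N powr s * lerch_phi w s (of_nat N * v)
           = (\<Sum>t<N. w ^ t * lerch_phi (w ^ N) s (v + of_nat t / of_nat N))"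
    if "norm w < 1 \<or> norm w \<le> 1 \<and> Re s > 1" for w s
  proof -
    have "norm (w ^ N) < 1 \<or> norm (w ^ N) \<le> 1 \<and> Re s > 1"
      using that N by (auto simp: norm_power power_less_one_iff power_le_one)
    then show ?thesis
      using lerch_series_distribution[OF N that, of v] that by (simp add: lerch_phi_eq_series)
  qed
  from w show ?thesis
  proof
    assume wN: "w ^ N \<notin> lerch_cut"
    define D where "D = {w :: complex. w ^ N \<notin> lerch_cut}"
    have cut_pow: "x ^ N \<in> lerch_cut" if "x \<in> lerch_cut" for x
      using that by (auto simp: lerch_cut_def simp flip: of_real_power)
    show ?thesis
    proof (rule analytic_continuation_open[of "ball 0 1" D
        "\<lambda>w. of_nat N powr s * lerch_phi w s (of_nat N * v)"
        "\<lambda>w. \<Sum>t<N. w ^ t * lerch_phi (w ^ N) s (v + of_nat t / of_nat N)" w])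
      have "D = (\<lambda>w. w ^ N) -` (- lerch_cut)" by (auto simp: D_def)
      then show "open D"
        by (simp add: open_vimage open_Compl_lerch_cut continuous_intros)
      have "starlike D"
        unfolding starlike_def
      proof (intro bexI ballI subsetI)
        show "0 \<in> D" using N by (auto simp: D_def lerch_cut_def power_0_left)
        fix z x assume z: "z \<in> D" and "x \<in> closed_segment 0 z"
        then obtain u where u: "0 \<le> u" "u \<le> 1" "x = of_real u * z"
          by (auto simp: in_segment scaleR_conv_of_real)
        show "x \<in> D"
        proof (rule ccontr)
          assume "x \<notin> D"
          then obtain y where y: "x ^ N = of_real y" "y \<ge> 1" by (auto simp: D_def lerch_cut_def)
          have "u \<noteq> 0" using u y N by (auto simp: power_0_left)
          then have "z ^ N = of_real (y / u ^ N)" using u y by (simp add: power_mult_distrib field_simps)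
          moreover have "u ^ N \<le> y" using u y power_le_one[of u N] by linarith
          then have "y / u ^ N \<ge> 1" using u \<open>u \<noteq> 0\<close> by (simp add: field_simps)
          ultimately have "z ^ N \<in> lerch_cut"
            unfolding lerch_cut_def by (intro image_eqI[of _ _ "y / u ^ N"]) auto
          then show False using z by (simp add: D_def)
        qed
      qed
      then show "connected D" by (rule starlike_imp_connected)
      show "ball 0 1 \<subseteq> D"
      proof
        fix x :: complex assume "x \<in> ball 0 1"
        then have "x ^ N \<in> ball 0 1" using N by (simp add: norm_power power_less_one_iff)
        then show "x \<in> D" using ball_subset_Compl_lerch_cut by (auto simp: D_def)
      qed
      have "D \<subseteq> - lerch_cut" using cut_pow by (auto simp: D_def)
      then show "(\<lambda>w. of_nat N powr s * lerch_phi w s (of_nat N * v)) holomorphic_on D"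
        by (intro holomorphic_intros holomorphic_on_subset[OF lerch_phi_holomorphic[OF v]])
      have "((\<lambda>z. lerch_phi z s (v + of_nat t / of_nat N)) \<circ> (\<lambda>w. w ^ N)) holomorphic_on D" for t
        by (rule holomorphic_on_compose_gen[OF _ lerch_phi_holomorphic[OF vt]])
          (auto simp: D_def intro: holomorphic_intros)
      then show "(\<lambda>w. \<Sum>t<N. w ^ t * lerch_phi (w ^ N) s (v + of_nat t / of_nat N)) holomorphic_on D"
        unfolding o_def by (intro holomorphic_intros)
      show "w \<in> D" using wN by (simp add: D_def)
    qed (auto intro: series)
  next
    assume "w ^ N = 1 \<and> s \<noteq> 1"
    then have wN: "w ^ N = 1" and s: "s \<noteq> 1" by auto
    have w1: "norm w = 1"
      using wN N by (metis norm_one norm_power norm_ge_zero power_eq_1_iff neq0_conv)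
    show ?thesis
    proof (rule analytic_continuation_open[of "{s. Re s > 1}" "- {1}"
        "\<lambda>s. of_nat N powr s * lerch_phi w s (of_nat N * v)"
        "\<lambda>s. \<Sum>t<N. w ^ t * lerch_phi (w ^ N) s (v + of_nat t / of_nat N)" s])
      show "connected (- {1 :: complex})"
        by (rule connected_punctured_universe) simp
      have "(2::complex) \<in> {s. Re s > 1}" by simp
      then show "{s. Re s > 1} \<noteq> {}" by blast
      show "(\<lambda>s. of_nat N powr s * lerch_phi w s (of_nat N * v)) holomorphic_on - {1}"
        by (intro holomorphic_intros lerch_phi_holomorphic_in_exponent w1 v)
      show "(\<lambda>s. \<Sum>t<N. w ^ t * lerch_phi (w ^ N) s (v + of_nat t / of_nat N)) holomorphic_on - {1}"
        unfolding wN by (intro holomorphic_intros lerch_phi_holomorphic_in_exponent vt) simp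
    qed (use w1 s series in \<open>auto intro: open_halfspace_Re_gt\<close>)
  qed
qed

text \<open>
The indices other than \<open>0\<close> and \<open>h\<close> are paired by the reflection \<open>t \<mapsto> 2 h - t\<close>.
\<close>

lemma sum_lessThan_reflect:
  fixes f :: "nat \<Rightarrow> 'a :: comm_monoid_add"
  assumes "h > 0"
  shows "(\<Sum>t<2 * h. f t) = (f 0 + f h) + (\<Sum>r = 1..h - 1. f r + f (2 * h - r))"
proof -
  have "(\<Sum>t<2 * h. f t) = (\<Sum>t\<in>{0..<h}. f t) + (\<Sum>t\<in>{h..<2 * h}. f t)"
    by (simp add: sum.atLeastLessThan_concat lessThan_atLeast0)
  also have "(\<Sum>t\<in>{0..<h}. f t) = f 0 + (\<Sum>r = 1..h - 1. f r)"
  proof -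
    have "{Suc 0..<h} = {1..h - 1}" using assms by auto
    then show ?thesis using assms by (simp add: sum.atLeast_Suc_lessThan)
  qed
  also have "(\<Sum>t\<in>{h..<2 * h}. f t) = f h + (\<Sum>r = 1..h - 1. f (2 * h - r))"
  proof -
    have "(\<Sum>t\<in>{Suc h..<2 * h}. f t) = (\<Sum>r = 1..h - 1. f (2 * h - r))"
      by (rule sum.reindex_bij_witness[of _ "\<lambda>r. 2 * h - r" "\<lambda>t. 2 * h - t"]) auto
    then show ?thesis using assms by (simp add: sum.atLeast_Suc_lessThan)
  qed
  finally show ?thesis by (simp add: sum.distrib ac_simps)
qed

theorem theorem4p128:
  fixes n :: nat and k m z :: complex
  assumes "n > 0" and "even n"
    and "\<And>r. r \<in> {1..(n - 2) div 2} \<Longrightarrow>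
           lerch_phi_defined (exp (2 * \<i> * m * pi)) (- k) (of_nat r / of_nat n + z / 2)"
    and "\<And>r. r \<in> {1..(n - 2) div 2} \<Longrightarrow>
           lerch_phi_defined (exp (2 * \<i> * m * pi)) (- k)
             (1 / 2 * (- (2 * of_nat r / of_nat n) + z + 2))"
    and "lerch_phi_defined (exp (2 * \<i> * m * pi / of_nat n)) (- k) (of_nat n * z / 2)"
    and "lerch_phi_defined (exp (\<i> * m * pi)) (- k) z"
  shows "(\<Sum>r = 1..(n - 2) div 2.
            exp (2 * \<i> * pi * m * of_nat r / of_nat n) *
              lerch_phi (exp (2 * \<i> * m * pi)) (- k) (of_nat r / of_nat n + z / 2)
            + (- 1) powr (2 * m) * exp (- (2 * \<i> * pi * m * of_nat r / of_nat n)) *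
              lerch_phi (exp (2 * \<i> * m * pi)) (- k)
                (1 / 2 * (- (2 * of_nat r / of_nat n) + z + 2)))
         = of_nat n powr (- k) *
             lerch_phi (exp (2 * \<i> * m * pi / of_nat n)) (- k) (of_nat n * z / 2)
           - 2 powr (- k) * lerch_phi (exp (\<i> * m * pi)) (- k) z"
proof (cases "n = 2")
  case True
  then show ?thesis by (simp add: mult.assoc)
next
  case False
  from \<open>even n\<close> obtain h where n: "n = 2 * h" by blast
  with \<open>n > 0\<close> False have h: "h > 1" by (cases h) auto
  define w q where "w = exp (2 * \<i> * m * pi / of_nat n)" and "q = exp (2 * \<i> * m * pi)"
  define f where "f = (\<lambda>t. w ^ t * lerch_phi q (- k) (z / 2 + of_nat t / of_nat n))"
  have w_pow: "w ^ t = exp (2 * \<i> * pi * m * of_nat t / of_nat n)" for t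
    unfolding w_def by (subst exp_of_nat_mult[symmetric]) (simp add: mult_ac)
  have w_n: "w ^ n = q" using \<open>n > 0\<close> by (simp add: w_pow q_def mult_ac)
  have w_h: "w ^ h = exp (\<i> * m * pi)" using h by (simp add: w_pow n mult_ac)
  have sq: "exp (\<i> * m * pi) ^ 2 = q"
    unfolding q_def by (subst exp_of_nat_mult[symmetric]) (simp add: mult_ac)
  \<comment> \<open>The hypotheses constrain \<open>q\<close> through the summands; \<open>n \<noteq> 2\<close> ensures that there is one.\<close>
  have "1 \<in> {1..(n - 2) div 2}" using h n by auto
  from assms(3)[OF this] have q: "q \<notin> lerch_cut \<or> q = 1 \<and> - k \<noteq> 1"
    by (simp add: lerch_phi_defined_def q_def)
  have "of_nat n powr (- k) * lerch_phi w (- k) (of_nat n * (z / 2))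
      = (\<Sum>t<n. w ^ t * lerch_phi (w ^ n) (- k) (z / 2 + of_nat t / of_nat n))"
    using \<open>n > 0\<close> assms(5) q
    by (intro lerch_phi_distribution) (simp_all add: w_n lerch_phi_defined_def)
  then have dist_n: "of_nat n powr (- k) * lerch_phi w (- k) (of_nat n * z / 2) = (\<Sum>t<n. f t)"
    by (simp add: w_n f_def)
  have "of_nat 2 powr (- k) * lerch_phi (exp (\<i> * m * pi)) (- k) (of_nat 2 * (z / 2))
      = (\<Sum>t<2. exp (\<i> * m * pi) ^ t * lerch_phi (exp (\<i> * m * pi) ^ 2) (- k) (z / 2 + of_nat t / of_nat 2))"
    using assms(6) q
    by (intro lerch_phi_distribution) (simp_all only: sq lerch_phi_defined_def, simp_all)
  moreover have "(\<Sum>t<2. g t) = g 0 + g 1" for g :: "nat \<Rightarrow> complex"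
    by (simp add: numeral_2_eq_2)
  ultimately have "2 powr (- k) * lerch_phi (exp (\<i> * m * pi)) (- k) z
      = lerch_phi q (- k) (z / 2) + exp (\<i> * m * pi) * lerch_phi q (- k) (z / 2 + 1 / 2)"
    unfolding sq by simp
  moreover have half: "of_nat h / of_nat n = (1 / 2 :: complex)" using h by (simp add: n)
  have "f h = exp (\<i> * m * pi) * lerch_phi q (- k) (z / 2 + 1 / 2)"
    unfolding f_def w_h half ..
  moreover have "f 0 = lerch_phi q (- k) (z / 2)" by (simp add: f_def)
  ultimately have dist_2: "2 powr (- k) * lerch_phi (exp (\<i> * m * pi)) (- k) z = f 0 + f h"
    by (simp only:)
  have reflect: "f (n - r) = (- 1) powr (2 * m) * exp (- (2 * \<i> * pi * m * of_nat r / of_nat n)) *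
              lerch_phi q (- k) (1 / 2 * (- (2 * of_nat r / of_nat n) + z + 2))"
    if "r \<in> {1..h - 1}" for r
  proof -
    have "r \<le> n" using that n by auto
    then have frac: "of_nat (n - r) / of_nat n = (1 - of_nat r / of_nat n :: complex)"
      using \<open>n > 0\<close> by (simp add: of_nat_diff field_simps)
    have "w ^ (n - r) = exp (2 * \<i> * pi * m * (of_nat (n - r) / of_nat n))" by (simp add: w_pow)
    also have "\<dots> = exp (2 * \<i> * pi * m + - (2 * \<i> * pi * m * of_nat r / of_nat n))"
      unfolding frac by (simp add: algebra_simps)
    also have "\<dots> = exp (2 * \<i> * pi * m) * exp (- (2 * \<i> * pi * m * of_nat r / of_nat n))"
      by (rule exp_add)
    also have "exp (2 * \<i> * pi * m) = (- 1) powr (2 * m)"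
      by (simp add: powr_def mult_ac)
    finally have "w ^ (n - r) = (- 1) powr (2 * m) * exp (- (2 * \<i> * pi * m * of_nat r / of_nat n))" .
    moreover have "z / 2 + of_nat (n - r) / of_nat n = 1 / 2 * (- (2 * of_nat r / of_nat n) + z + 2)"
      unfolding frac by (simp add: algebra_simps)
    ultimately show ?thesis unfolding f_def by (simp only:)
  qed
  have "(\<Sum>r = 1..(n - 2) div 2.
            exp (2 * \<i> * pi * m * of_nat r / of_nat n) * lerch_phi q (- k) (of_nat r / of_nat n + z / 2)
            + (- 1) powr (2 * m) * exp (- (2 * \<i> * pi * m * of_nat r / of_nat n)) *
              lerch_phi q (- k) (1 / 2 * (- (2 * of_nat r / of_nat n) + z + 2)))
      = (\<Sum>r = 1..h - 1. f r + f (2 * h - r))"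
  proof (rule sum.cong)
    show "{1..(n - 2) div 2} = {1..h - 1}" using n by auto
    fix r assume "r \<in> {1..h - 1}"
    from reflect[OF this]
    show "exp (2 * \<i> * pi * m * of_nat r / of_nat n) * lerch_phi q (- k) (of_nat r / of_nat n + z / 2)
            + (- 1) powr (2 * m) * exp (- (2 * \<i> * pi * m * of_nat r / of_nat n)) *
              lerch_phi q (- k) (1 / 2 * (- (2 * of_nat r / of_nat n) + z + 2)) = f r + f (2 * h - r)"
      unfolding n[symmetric] by (simp only: f_def w_pow add.commute[of "z / 2"])
  qed
  also have "\<dots> = (\<Sum>t<n. f t) - (f 0 + f h)"
    using h by (simp add: n sum_lessThan_reflect)
  finally show ?thesis
    unfolding dist_n[symmetric] dist_2[symmetric] by (simp only: w_def q_def)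
qed

end
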